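(* Let $G$ be a graph with vertex set $[n]$. The commutative quotient $\mathcal E_G^{ab}$ of the Fomin–Kirillov algebra $\mathcal E_G$ is isomorphic to the Orlik–Terao algebra $U_G$ (via $x_{ij}\mapsto u_{ij}$).
   Context: The Fomin–Kirillov algebra $\mathcal E_n$ is the quadratic $\mathbf Q$-algebra with generators $x_{ij}=-x_{ji}$ for distinct $i,j\in[n]$, subject to: $x_{ij}^2=0$ for distinct $i,j$; $x_{ij}x_{kl}=x_{kl}x_{ij}$ for distinct $i,j,k,l$; $x_{ij}x_{jk}+x_{jk}x_{ki}+x_{ki}x_{ij}=0$ for distinct $i,j,k$. For a graph $G$ on $[n]$, $\mathcal E_G$ is the subalgebra of $\mathcal E_n$ generated by $x_{ij}$ for edges $\overline{ij}$ of $G$, and $\mathcal E_G^{ab}$ is the quotient of $\mathcal E_G$ by the two-sided ideal generated by all commutators $ab-ba$, $a,b\in\mathcal E_G$ (equivalently by $x_{ij}x_{kl}-x_{kl}x_{ij}$ for edges of $G$). The Orlik–Terao algebra $U_G$ is the commutative $\mathbf Q$-algebra with generators $u_{ij}=-u_{ji}$ for edges $\overline{ij}$ of $G$, subject to: (1) a monomial in the $u_{ij}$ vanishes if it has a repeated variable or its support (the set of edges whose variable occurs) contains a cycle; (2) for every linear dependence $\sum_{p=1}^k c_p(e_{i_p}-e_{j_p})=0$ in $\mathbf R^n$ among vectors indexed by edges $\overline{i_pj_p}$ of $G$, the relation $\sum_{p=1}^k c_p\prod_{q\ne p}u_{i_qj_q}=0$. *)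

theory Defs
  imports Complex_Main "HOL-Library.Multiset"
begin

text \<open>Variables are ordered pairs (i,j); a noncommutative polynomial is a finitely
supported function from words (lists of variables) to rationals.\<close>

type_synonym ncpoly = "(nat \<times> nat) list \<Rightarrow> rat"

definition nc_fin :: "ncpoly \<Rightarrow> bool" where
  "nc_fin p \<longleftrightarrow> finite {w. p w \<noteq> 0}"

definition nc_over :: "(nat \<times> nat) set \<Rightarrow> ncpoly \<Rightarrow> bool" where
  "nc_over V p \<longleftrightarrow> nc_fin p \<and> (\<forall>w. p w \<noteq> 0 \<longrightarrow> set w \<subseteq> V)"

definition nc_zero :: ncpoly where "nc_zero = (\<lambda>_. 0)"
definition nc_add :: "ncpoly \<Rightarrow> ncpoly \<Rightarrow> ncpoly" where "nc_add p q = (\<lambda>w. p w + q w)"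
definition nc_sub :: "ncpoly \<Rightarrow> ncpoly \<Rightarrow> ncpoly" where "nc_sub p q = (\<lambda>w. p w - q w)"
definition nc_mul :: "ncpoly \<Rightarrow> ncpoly \<Rightarrow> ncpoly" where
  "nc_mul p q = (\<lambda>w. \<Sum>k\<le>length w. p (take k w) * q (drop k w))"
definition nc_var :: "nat \<Rightarrow> nat \<Rightarrow> ncpoly" where
  "nc_var i j = (\<lambda>w. if w = [(i, j)] then 1 else 0)"
definition nc_comm :: "ncpoly \<Rightarrow> ncpoly \<Rightarrow> ncpoly" where
  "nc_comm a b = nc_sub (nc_mul a b) (nc_mul b a)"

inductive_set nc_ideal :: "(nat \<times> nat) set \<Rightarrow> ncpoly set \<Rightarrow> ncpoly set"
  for V :: "(nat \<times> nat) set" and S :: "ncpoly set" where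
  zero: "nc_zero \<in> nc_ideal V S"
| gen: "s \<in> S \<Longrightarrow> s \<in> nc_ideal V S"
| add: "p \<in> nc_ideal V S \<Longrightarrow> q \<in> nc_ideal V S \<Longrightarrow> nc_add p q \<in> nc_ideal V S"
| mul: "p \<in> nc_ideal V S \<Longrightarrow> nc_over V a \<Longrightarrow> nc_over V b \<Longrightarrow>
        nc_mul (nc_mul a p) b \<in> nc_ideal V S"

definition FK_vars :: "nat \<Rightarrow> (nat \<times> nat) set" where
  "FK_vars n = {(i, j). i \<in> {1..n} \<and> j \<in> {1..n} \<and> i \<noteq> j}"

definition FK_rels :: "nat \<Rightarrow> ncpoly set" where
  "FK_rels n =
     {nc_add (nc_var i j) (nc_var j i) | i j. (i, j) \<in> FK_vars n}
   \<union> {nc_mul (nc_var i j) (nc_var i j) | i j. (i, j) \<in> FK_vars n}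
   \<union> {nc_comm (nc_var i j) (nc_var k l) | i j k l.
        i \<in> {1..n} \<and> j \<in> {1..n} \<and> k \<in> {1..n} \<and> l \<in> {1..n} \<and> distinct [i, j, k, l]}
   \<union> {nc_add (nc_add (nc_mul (nc_var i j) (nc_var j k)) (nc_mul (nc_var j k) (nc_var k i)))
             (nc_mul (nc_var k i) (nc_var i j)) | i j k.
        i \<in> {1..n} \<and> j \<in> {1..n} \<and> k \<in> {1..n} \<and> distinct [i, j, k]}"

text \<open>E_n = (free algebra on FK_vars n) / FK_ideal n.\<close>
definition FK_ideal :: "nat \<Rightarrow> ncpoly set" where
  "FK_ideal n = nc_ideal (FK_vars n) (FK_rels n)"

text \<open>E_G is the image in E_n of the polynomials over the edge variables E (a symmetric
edge relation).  Commutator ideal of E_G, pulled back to the polynomials over E: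
the ideal of the algebra of E-polynomials generated by all commutators [a,b] of
E-polynomials.  The kernel of the natural surjection (free algebra on the edge
variables) -> E_G^ab is then the set below.\<close>
definition FK_ab_kernel :: "nat \<Rightarrow> (nat \<times> nat) set \<Rightarrow> ncpoly set" where
  "FK_ab_kernel n E =
     {p. nc_over E p \<and>
         (\<exists>q \<in> nc_ideal E {nc_comm a b | a b. nc_over E a \<and> nc_over E b}.
            nc_sub p q \<in> FK_ideal n)}"

type_synonym cpoly = "(nat \<times> nat) multiset \<Rightarrow> rat"

definition c_fin :: "cpoly \<Rightarrow> bool" where
  "c_fin p \<longleftrightarrow> finite {m. p m \<noteq> 0}"
definition c_over :: "(nat \<times> nat) set \<Rightarrow> cpoly \<Rightarrow> bool" where
  "c_over V p \<longleftrightarrow> c_fin p \<and> (\<forall>m. p m \<noteq> 0 \<longrightarrow> set_mset m \<subseteq> V)"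
definition c_zero :: cpoly where "c_zero = (\<lambda>_. 0)"
definition c_add :: "cpoly \<Rightarrow> cpoly \<Rightarrow> cpoly" where "c_add p q = (\<lambda>m. p m + q m)"
definition c_mul :: "cpoly \<Rightarrow> cpoly \<Rightarrow> cpoly" where
  "c_mul p q = (\<lambda>m. \<Sum>a\<in>{a. a \<subseteq># m}. p a * q (m - a))"
definition c_mono :: "(nat \<times> nat) multiset \<Rightarrow> cpoly" where
  "c_mono m = (\<lambda>m'. if m' = m then 1 else 0)"

inductive_set c_ideal :: "(nat \<times> nat) set \<Rightarrow> cpoly set \<Rightarrow> cpoly set"
  for V :: "(nat \<times> nat) set" and S :: "cpoly set" where
  zero: "c_zero \<in> c_ideal V S"
| gen: "s \<in> S \<Longrightarrow> s \<in> c_ideal V S"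
| add: "p \<in> c_ideal V S \<Longrightarrow> q \<in> c_ideal V S \<Longrightarrow> c_add p q \<in> c_ideal V S"
| mul: "p \<in> c_ideal V S \<Longrightarrow> c_over V a \<Longrightarrow> c_mul a p \<in> c_ideal V S"

definition has_cycle :: "(nat \<times> nat) set \<Rightarrow> bool" where
  "has_cycle F \<longleftrightarrow> (\<exists>vs. length vs \<ge> 3 \<and> distinct vs \<and>
      (\<forall>i < length vs. (vs ! i, vs ! ((i + 1) mod length vs)) \<in> F
                    \<or> (vs ! ((i + 1) mod length vs), vs ! i) \<in> F))"

text \<open>A monomial has a repeated variable (u_ij and u_ji = -u_ij count as the same variable).\<close>
definition has_repeat :: "(nat \<times> nat) multiset \<Rightarrow> bool" where
  "has_repeat m \<longleftrightarrow> (\<exists>i j. count m (i, j) + count m (j, i) \<ge> 2)"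

definition OT_rels :: "nat \<Rightarrow> (nat \<times> nat) set \<Rightarrow> cpoly set" where
  "OT_rels n E =
     {c_add (c_mono {#(i, j)#}) (c_mono {#(j, i)#}) | i j. (i, j) \<in> E}
   \<union> {c_mono m | m. set_mset m \<subseteq> E \<and> (has_repeat m \<or> has_cycle (set_mset m))}
   \<union> {(\<lambda>m. \<Sum>p<length ps. cs ! p *
              (if m = mset (take p ps @ drop (Suc p) ps) then 1 else 0)) | ps cs.
        length cs = length ps \<and> set ps \<subseteq> E \<and>
        distinct (map (\<lambda>(i, j). {i, j}) ps) \<and>
        (\<forall>v. (\<Sum>p<length ps. cs ! p *
              ((if v = fst (ps ! p) then 1 else 0) - (if v = snd (ps ! p) then 1 else 0))) = 0)}"

text \<open>U_G = (polynomials over the edge variables) / OT_ideal n E.\<close>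
definition OT_ideal :: "nat \<Rightarrow> (nat \<times> nat) set \<Rightarrow> cpoly set" where
  "OT_ideal n E = c_ideal E (OT_rels n E)"

definition ab :: "ncpoly \<Rightarrow> cpoly" where
  "ab p = (\<lambda>m. \<Sum>w\<in>{w. p w \<noteq> 0 \<and> mset w = m}. p w)"

end

theory Submission
  imports Defs "HOL-Library.Function_Algebras" "HOL-Library.Nat_Bijection"
begin

text \<open>
  Both inclusions are proved by duality: a polynomial lies in a subspace iff every linear functional
  vanishing on the subspace kills it, so all computations take place with rational-valued functions
  on words or on multisets of edges.

  A functional killing the Fomin--Kirillov ideal satisfies, for every cycle \<open>a\<^sub>1 \<dots> a\<^sub>k\<close>, the relation that
  the sum over all rotations of the path monomials \<open>x(a\<^sub>1,a\<^sub>2) \<dots> x(a\<^sub>k\<^sub>-\<^sub>1,a\<^sub>k)\<close> vanishes. If in addition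
  it is symmetric in the edge variables of \<open>G\<close>, it therefore kills the Orlik--Terao relations, because
  every circulation on \<open>G\<close> is a linear combination of cycles, and because multiplying the relation of
  a cycle by one of its edges shows that the cycle monomial vanishes.

  For the converse one has to show that \<open>U\<^sub>G\<close> embeds into the commutative quotient of the whole algebra
  \<open>E\<^sub>n\<close>. Interpreting \<open>u\<^sub>i\<^sub>j\<close> as \<open>1/(x\<^sub>i - x\<^sub>j)\<close>, iterated residues along a sequence of edges give functionals
  on monomials that satisfy all Fomin--Kirillov relations. The residues along the sets of edges of \<open>G\<close>
  without broken circuits are dual to the corresponding monomials, and these monomials span \<open>U\<^sub>G\<close>.
\<close>

section \<open>Pairing polynomials with functionals\<close>

text \<open>The residues come from the identity \<open>1/(p q) + 1/(q r) + 1/(r p) = 0\<close> for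
  \<open>p + q + r = 0\<close>, which is the triangle relation when \<open>p\<close>,
  \<open>q\<close>, \<open>r\<close> are the differences along a triangle. The obstacle is that the
  Fomin--Kirillov ideal involves all pairs of vertices, so a relation among edges of
  \<open>G\<close> may be derived through chords outside \<open>G\<close>; the cycle relation is
  obtained in this way. Hence a functional on monomials over \<open>G\<close> has to be extended to
  all words before the ideal can be tested on it. Residues depend only on the vectors
  \<open>e_i - e_j\<close> and are defined for every set of pairs, so they carry such an extension
  with them. The substitution itself does not annihilate squares; these are given the value 0. The
  triangle relation survives: if one of its factors already occurs in the monomial, any squarefree
  term that remains contains a whole triangle and has residue 0. The order on edges serves to pair
  monomials without broken circuits with residues taken from the largest edge downwards; the matrix
  of this pairing is the identity.\<close>

definition pr :: "('x \<Rightarrow> rat) \<Rightarrow> ('x \<Rightarrow> rat) \<Rightarrow> rat" where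
  "pr f \<mu> = (\<Sum>x | f x \<noteq> 0. f x * \<mu> x)"

lemma pr_superset:
  assumes "finite A" "\<And>x. f x \<noteq> 0 \<Longrightarrow> x \<in> A"
  shows "pr f \<mu> = (\<Sum>x\<in>A. f x * \<mu> x)"
  unfolding pr_def using assms by (intro sum.mono_neutral_left) auto

lemma pr_add:
  assumes "finite {x. f x \<noteq> 0}" "finite {x. g x \<noteq> 0}"
  shows "pr (\<lambda>x. f x + g x) \<mu> = pr f \<mu> + pr g \<mu>"
proof -
  let ?A = "{x. f x \<noteq> 0} \<union> {x. g x \<noteq> 0}"
  have "pr f \<mu> = (\<Sum>x\<in>?A. f x * \<mu> x)" "pr g \<mu> = (\<Sum>x\<in>?A. g x * \<mu> x)"
    "pr (\<lambda>x. f x + g x) \<mu> = (\<Sum>x\<in>?A. (f x + g x) * \<mu> x)"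
    using assms by (auto intro!: pr_superset)
  then show ?thesis by (simp add: sum.distrib distrib_right)
qed

lemma pr_sub:
  assumes "finite {x. f x \<noteq> 0}" "finite {x. g x \<noteq> 0}"
  shows "pr (\<lambda>x. f x - g x) \<mu> = pr f \<mu> - pr g \<mu>"
proof -
  let ?A = "{x. f x \<noteq> 0} \<union> {x. g x \<noteq> 0}"
  have "pr f \<mu> = (\<Sum>x\<in>?A. f x * \<mu> x)" "pr g \<mu> = (\<Sum>x\<in>?A. g x * \<mu> x)"
    "pr (\<lambda>x. f x - g x) \<mu> = (\<Sum>x\<in>?A. (f x - g x) * \<mu> x)"
    using assms by (auto intro!: pr_superset)
  then show ?thesis by (simp add: sum_subtractf left_diff_distrib)
qed

lemma pr_cong: "(\<And>x. f x \<noteq> 0 \<Longrightarrow> \<mu> x = \<mu>' x) \<Longrightarrow> pr f \<mu> = pr f \<mu>'"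
  unfolding pr_def by (intro sum.cong) auto

lemma pr_eq_0: "(\<And>x. f x \<noteq> 0 \<Longrightarrow> \<mu> x = 0) \<Longrightarrow> pr f \<mu> = 0"
  unfolding pr_def by (intro sum.neutral) auto

lemma pr_indicator: "pr (\<lambda>x. if x = a then 1 else 0) \<mu> = \<mu> a"
  by (subst pr_superset[of "{a}"]) (auto split: if_splits)

lemma pr_commute:
  "pr f (\<lambda>x. pr g (\<lambda>y. h x y)) = pr g (\<lambda>y. pr f (\<lambda>x. h x y))"
  unfolding pr_def sum_distrib_left by (subst sum.swap) (simp add: mult_ac)

text \<open>Pairing with a pushforward along \<open>g\<close> is pairing with the pullback. Both
  products and \<open>ab\<close> are pushforwards, along concatenation, multiset sum and
  \<open>mset\<close>.\<close>

lemma pr_push: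
  assumes "finite (A::'a set)" "finite B"
    and "\<And>x. x \<in> A \<Longrightarrow> g x \<in> B"
  shows "(\<Sum>y\<in>B. (\<Sum>x\<in>{x\<in>A. g x = y}. F x) * \<mu> y) = (\<Sum>x\<in>A. F x * (\<mu> (g x) :: rat))"
proof -
  have "(\<Sum>y\<in>B. (\<Sum>x\<in>{x\<in>A. g x = y}. F x) * \<mu> y) = (\<Sum>y\<in>B. (\<Sum>x\<in>{x\<in>A. g x = y}. F x * \<mu> (g x)))"
    by (simp add: sum_distrib_right)
  also have "\<dots> = (\<Sum>x\<in>A. F x * \<mu> (g x))"
    using assms by (intro sum.group) auto
  finally show ?thesis .
qed

text \<open>Trades the sum over cut positions of \<open>w\<close> for a sum over a fibre of
  concatenation, the shape that \<open>pr_push\<close> expects.\<close>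

lemma nc_mul_eq:
  assumes "nc_fin a" "nc_fin b"
  shows "nc_mul a b w = (\<Sum>x\<in>{x\<in>{u. a u \<noteq> 0} \<times> {v. b v \<noteq> 0}. fst x @ snd x = w}. a (fst x) * b (snd x))"
proof -
  let ?T = "(\<lambda>k. (take k w, drop k w)) ` {..length w}"
  have inj: "inj_on (\<lambda>k. (take k w, drop k w)) {..length w}"
    by (rule inj_onI) (metis Pair_inject atMost_iff length_take min.absorb2)
  have T: "?T = {x. fst x @ snd x = w}"
  proof (safe, goal_cases)
    case (2 u v)
    then show ?case by (auto intro!: image_eqI[of _ _ "length u"])
  qed simp
  have "nc_mul a b w = (\<Sum>x\<in>?T. a (fst x) * b (snd x))"
    unfolding nc_mul_def by (subst sum.reindex[OF inj]) simp
  also have "\<dots> = (\<Sum>x\<in>{x\<in>{u. a u \<noteq> 0} \<times> {v. b v \<noteq> 0}. fst x @ snd x = w}. a (fst x) * b (snd x))"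
  proof (intro sum.mono_neutral_right)
    show "finite ?T" by simp
  qed (use T in auto)
  finally show ?thesis .
qed

lemma nc_mul_supp:
  assumes "nc_mul a b w \<noteq> 0"
  obtains u v where "a u \<noteq> 0" "b v \<noteq> 0" "w = u @ v"
proof -
  from assms obtain k where "a (take k w) * b (drop k w) \<noteq> 0"
    unfolding nc_mul_def by (meson sum.neutral)
  then show thesis by (intro that[of "take k w" "drop k w"]) auto
qed

lemma nc_fin_mul:
  assumes "nc_fin a" "nc_fin b" shows "nc_fin (nc_mul a b)"
proof -
  have "{w. nc_mul a b w \<noteq> 0} \<subseteq> (\<lambda>x. fst x @ snd x) ` ({u. a u \<noteq> 0} \<times> {v. b v \<noteq> 0})"
    by (auto elim!: nc_mul_supp) force
  then show ?thesis using assms finite_subset unfolding nc_fin_def by blast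
qed

lemma pr_nc_mul:
  assumes "nc_fin a" "nc_fin b"
  shows "pr (nc_mul a b) \<mu> = pr a (\<lambda>u. pr b (\<lambda>v. \<mu> (u @ v)))"
proof -
  let ?A = "{u. a u \<noteq> 0} \<times> {v. b v \<noteq> 0}"
  have fin: "finite ?A" using assms by (simp add: nc_fin_def)
  let ?B = "(\<lambda>x. fst x @ snd x) ` ?A"
  have "pr (nc_mul a b) \<mu> = (\<Sum>w\<in>?B. nc_mul a b w * \<mu> w)"
    using fin by (intro pr_superset) (auto elim!: nc_mul_supp, force)
  also have "\<dots> = (\<Sum>x\<in>?A. a (fst x) * b (snd x) * \<mu> (fst x @ snd x))"
    unfolding nc_mul_eq[OF assms] using fin by (intro pr_push) auto
  also have "\<dots> = pr a (\<lambda>u. pr b (\<lambda>v. \<mu> (u @ v)))"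
    unfolding pr_def sum_distrib_left sum.cartesian_product by (simp add: case_prod_beta mult_ac)
  finally show ?thesis .
qed

lemma finite_submset: "finite {x. x \<subseteq># w}"
proof (rule finite_subset)
  show "{x. x \<subseteq># w} \<subseteq> mset ` {xs. set xs \<subseteq> set_mset w \<and> length xs \<le> size w}"
  proof safe
    fix x assume x: "x \<subseteq># w"
    obtain xs where "mset xs = x" using ex_mset by blast
    with x show "x \<in> mset ` {xs. set xs \<subseteq> set_mset w \<and> length xs \<le> size w}"
      using set_mset_mono[OF x] size_mset_mono[OF x] by (intro image_eqI[of _ _ xs]) auto
  qed
qed (simp add: finite_lists_length_le)

lemma c_mul_eq:
  assumes "c_fin a" "c_fin b"
  shows "c_mul a b w = (\<Sum>x\<in>{x\<in>{u. a u \<noteq> 0} \<times> {v. b v \<noteq> 0}. fst x + snd x = w}. a (fst x) * b (snd x))"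
proof -
  have fin: "finite {x. x \<subseteq># w}" by (rule finite_submset)
  let ?T = "(\<lambda>k. (k, w - k)) ` {x. x \<subseteq># w}"
  have inj: "inj_on (\<lambda>k. (k, w - k)) {x. x \<subseteq># w}"
    by (rule inj_onI) auto
  have T: "?T = {x. fst x + snd x = w}"
  proof (safe, goal_cases)
    case (2 u v)
    then show ?case by (auto intro!: image_eqI[of _ _ u])
  qed simp
  have "c_mul a b w = (\<Sum>x\<in>?T. a (fst x) * b (snd x))"
    unfolding c_mul_def by (subst sum.reindex[OF inj]) simp
  also have "\<dots> = (\<Sum>x\<in>{x\<in>{u. a u \<noteq> 0} \<times> {v. b v \<noteq> 0}. fst x + snd x = w}. a (fst x) * b (snd x))"
  proof (intro sum.mono_neutral_right)
    show "finite ?T" using fin by simp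
  qed (use T in auto)
  finally show ?thesis .
qed

lemma c_mul_supp:
  assumes "c_mul a b w \<noteq> 0"
  obtains u v where "a u \<noteq> 0" "b v \<noteq> 0" "w = u + v"
proof -
  from assms obtain k where "k \<subseteq># w" "a k * b (w - k) \<noteq> 0"
    unfolding c_mul_def by (metis (mono_tags, lifting) mem_Collect_eq sum.neutral)
  then show thesis by (intro that[of k "w - k"]) auto
qed

lemma c_fin_mul:
  assumes "c_fin a" "c_fin b" shows "c_fin (c_mul a b)"
proof -
  have "{w. c_mul a b w \<noteq> 0} \<subseteq> (\<lambda>x. fst x + snd x) ` ({u. a u \<noteq> 0} \<times> {v. b v \<noteq> 0})"
    by (auto elim!: c_mul_supp) force
  then show ?thesis using assms finite_subset unfolding c_fin_def by blast
qed

lemma pr_c_mul: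
  assumes "c_fin a" "c_fin b"
  shows "pr (c_mul a b) \<mu> = pr a (\<lambda>u. pr b (\<lambda>v. \<mu> (u + v)))"
proof -
  let ?A = "{u. a u \<noteq> 0} \<times> {v. b v \<noteq> 0}"
  have fin: "finite ?A" using assms by (simp add: c_fin_def)
  let ?B = "(\<lambda>x. fst x + snd x) ` ?A"
  have "pr (c_mul a b) \<mu> = (\<Sum>w\<in>?B. c_mul a b w * \<mu> w)"
    using fin by (intro pr_superset) (auto elim!: c_mul_supp, force)
  also have "\<dots> = (\<Sum>x\<in>?A. a (fst x) * b (snd x) * \<mu> (fst x + snd x))"
    unfolding c_mul_eq[OF assms] using fin by (intro pr_push) auto
  also have "\<dots> = pr a (\<lambda>u. pr b (\<lambda>v. \<mu> (u + v)))"
    unfolding pr_def sum_distrib_left sum.cartesian_product by (simp add: case_prod_beta mult_ac)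
  finally show ?thesis .
qed

lemma ab_supp:
  assumes "ab p m \<noteq> 0" obtains w where "p w \<noteq> 0" "m = mset w"
  using assms unfolding ab_def by (metis (mono_tags, lifting) mem_Collect_eq sum.neutral)

lemma pr_ab:
  assumes "nc_fin p"
  shows "pr (ab p) \<nu> = pr p (\<lambda>w. \<nu> (mset w))"
proof -
  let ?A = "{w. p w \<noteq> 0}"
  have fin: "finite ?A" using assms by (simp add: nc_fin_def)
  have "pr (ab p) \<nu> = (\<Sum>m\<in>mset ` ?A. ab p m * \<nu> m)"
    using fin by (intro pr_superset) (auto elim!: ab_supp)
  also have "\<dots> = (\<Sum>w\<in>?A. p w * \<nu> (mset w))"
    using pr_push[OF fin finite_imageI[OF fin], where g = mset and F = p and \<mu> = \<nu>]
    unfolding ab_def by simp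
  finally show ?thesis by (simp add: pr_def)
qed

lemma sum_fun_apply: "(\<Sum>a\<in>A. (f a :: 'x \<Rightarrow> rat)) x = (\<Sum>a\<in>A. f a x)"
  by (induction A rule: infinite_finite_induct) auto

text \<open>A basis of \<open>K\<close> stays independent when \<open>p\<close> is added, so some
  linear \<open>g\<close> is 1 at \<open>p\<close> and 0 on \<open>K\<close>. Indicators do not span
  the space of all functions, but on finitely supported ones \<open>g\<close> is recovered from its
  values \<open>\<mu>\<close> on indicators.\<close>

lemma separating_functional:
  fixes K :: "('x \<Rightarrow> rat) set"
  assumes zero: "(\<lambda>_. 0) \<in> K"
    and add: "\<And>f g. f \<in> K \<Longrightarrow> g \<in> K \<Longrightarrow> (\<lambda>x. f x + g x) \<in> K"
    and scale: "\<And>f c. f \<in> K \<Longrightarrow> (\<lambda>x. c * f x) \<in> K"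
    and fin: "\<And>f. f \<in> K \<Longrightarrow> finite {x. f x \<noteq> 0}" "finite {x. p x \<noteq> 0}"
    and p: "p \<notin> K"
  obtains \<mu> where "\<And>f. f \<in> K \<Longrightarrow> pr f \<mu> = 0" "pr p \<mu> \<noteq> 0"
proof -
  interpret V: vector_space_pair "\<lambda>(c::rat) (f::'x \<Rightarrow> rat) x. c * f x" "\<lambda>(c::rat) (x::rat). c * x"
    by unfold_locales (auto simp: algebra_simps)
  have sub: "V.vs1.subspace K"
    unfolding V.vs1.subspace_def using assms(1-3) by (auto simp: zero_fun_def plus_fun_def)
  obtain B where B: "B \<subseteq> K" "V.vs1.independent B" "K \<subseteq> V.vs1.span B"
    using V.vs1.maximal_independent_subset[of K] by blast
  have "p \<notin> V.vs1.span B"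
    using V.vs1.span_minimal[OF B(1) sub] p by blast
  then have ind: "V.vs1.independent (insert p B)"
    using B(2) by (simp add: V.vs1.independent_insertI)
  obtain g where g: "Vector_Spaces.linear (\<lambda>(c::rat) (f::'x \<Rightarrow> rat) x. c * f x) (*) g"
    "\<forall>x\<in>insert p B. g x = (if x = p then 1 else 0)"
    using V.linear_independent_extend[OF ind, of "\<lambda>x. if x = p then 1 else 0"] by blast
  interpret g: Vector_Spaces.linear "\<lambda>(c::rat) (f::'x \<Rightarrow> rat) x. c * f x" "(*)" g by (rule g)
  define \<mu> where "\<mu> y = g (\<lambda>x. if x = y then 1 else 0)" for y
  have g_pr: "g f = pr f \<mu>" if "finite {x. f x \<noteq> 0}" for f
  proof -
    have "f = (\<Sum>y | f y \<noteq> 0. (\<lambda>x. f y * (if x = y then 1 else 0)))"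
      using that by (auto simp: fun_eq_iff sum_fun_apply if_distrib cong: if_cong)
    then have "g f = (\<Sum>y | f y \<noteq> 0. g (\<lambda>x. f y * (if x = y then 1 else 0)))"
      using g.sum by metis
    also have "\<dots> = pr f \<mu>"
      unfolding pr_def \<mu>_def using g.scale by simp
    finally show ?thesis .
  qed
  have "p \<notin> B" using B p by auto
  have "g f = 0" if "f \<in> V.vs1.span B" for f
    using that by (rule V.linear_eq_0_on_span[rotated 2]) (use g \<open>p \<notin> B\<close> in auto)
  then have "pr f \<mu> = 0" if "f \<in> K" for f
    using B(3) that g_pr[OF fin(1)[OF that]] by auto
  moreover have "pr p \<mu> \<noteq> 0" using g(2) g_pr[OF fin(2)] by auto
  ultimately show thesis using that by blast
qed

section \<open>Iterated residues\<close>

type_synonym edge = "nat \<times> nat"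
type_synonym vec = "nat \<Rightarrow> rat"

text \<open>For nonzero \<open>w\<close>, evaluation at this coordinate is a linear functional that
  does not vanish on \<open>w\<close>; it replaces the choice of a complement to the line spanned by
  \<open>w\<close>.\<close>

definition pivot :: "vec \<Rightarrow> nat" where
  "pivot w = (SOME k. w k \<noteq> 0)"

text \<open>For \<open>w \<noteq> 0\<close> this is a projection with kernel spanned by \<open>w\<close>; \<open>proj 0\<close> is the identity since \<open>x / 0 = 0\<close>.\<close>
definition proj :: "vec \<Rightarrow> vec \<Rightarrow> vec" where
  "proj w v = (\<lambda>x. v x - v (pivot w) / w (pivot w) * w x)"

text \<open>\<open>ratio w v = 1 / s\<close> if \<open>v = s w\<close> with \<open>s \<noteq> 0\<close> and \<open>w \<noteq> 0\<close>, and \<open>0\<close> in all other cases.\<close>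
definition ratio :: "vec \<Rightarrow> vec \<Rightarrow> rat" where
  "ratio w v = (if proj w v = (\<lambda>_. 0) then w (pivot w) / v (pivot w) else 0)"

text \<open>The iterated residue of the product of all \<open>1 / \<alpha> t\<close> (\<open>t \<in> T\<close>), taken first along \<open>\<alpha> b = 0\<close>; the
  restriction to this hyperplane is the replacement of \<open>\<alpha>\<close> by its projection.\<close>
fun residue :: "(edge \<Rightarrow> vec) \<Rightarrow> edge list \<Rightarrow> edge set \<Rightarrow> rat" where
  "residue \<alpha> [] T = (if T = {} then 1 else 0)"
| "residue \<alpha> (b # bs) T =
     (\<Sum>t\<in>T. ratio (\<alpha> b) (\<alpha> t) * residue (\<lambda>t. proj (\<alpha> b) (\<alpha> t)) bs (T - {t}))"

lemma pivot_nonzero: "w \<noteq> (\<lambda>_. 0) \<Longrightarrow> w (pivot w) \<noteq> 0"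
  unfolding pivot_def by (rule someI_ex) auto

lemma proj_self: "proj w w = (\<lambda>_. 0)"
proof (cases "w = (\<lambda>_. 0)")
  case False
  then show ?thesis using pivot_nonzero[OF False] by (simp add: proj_def)
qed (simp add: proj_def)

lemma ratio_self: "w \<noteq> (\<lambda>_. 0) \<Longrightarrow> ratio w w = 1"
  using pivot_nonzero[of w] by (simp add: ratio_def proj_self)

lemma proj_uminus: "proj w (\<lambda>x. - v x) = (\<lambda>x. - proj w v x)"
  by (auto simp: proj_def)

lemma ratio_uminus: "ratio w (\<lambda>x. - v x) = - ratio w v"
  by (auto simp: ratio_def proj_uminus fun_eq_iff)

lemma proj_sum:
  "proj w (\<lambda>x. \<Sum>t\<in>T. c t * \<alpha> t x) = (\<lambda>x. \<Sum>t\<in>T. c t * proj w (\<alpha> t) x)"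
  by (auto simp: proj_def right_diff_distrib sum_subtractf sum_distrib_left
      sum_divide_distrib mult_ac)

text \<open>A nonzero summand removes some \<open>s\<close> whose vector projects to 0. By induction
  the projections of the others are independent, which leaves only the coefficient of
  \<open>s\<close>, and the pivot coordinate kills that one too. In contrapositive form this is why
  cycles have residue 0.\<close>

lemma residue_nonzero_imp_independent:
  assumes "residue \<alpha> bs T \<noteq> 0" "finite T" "\<And>x. (\<Sum>t\<in>T. c t * \<alpha> t x) = 0" "t \<in> T"
  shows "c t = 0"
  using assms
proof (induction bs arbitrary: \<alpha> T t)
  case Nil
  then show ?case by (auto split: if_splits)
next
  case (Cons b bs)
  let ?\<alpha> = "\<lambda>t. proj (\<alpha> b) (\<alpha> t)"
  from Cons.prems(1) obtain s where s: "s \<in> T" "ratio (\<alpha> b) (\<alpha> s) \<noteq> 0" "residue ?\<alpha> bs (T - {s}) \<noteq> 0"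
    by (auto elim!: sum.not_neutral_contains_not_neutral)
  \<comment> \<open>Division by 0 gives 0, so a nonzero \<open>ratio\<close> also shows that
    \<open>\<alpha> s\<close> is nonzero at the pivot.\<close>
  from s(2) have s': "?\<alpha> s = (\<lambda>_. 0)" "\<alpha> s (pivot (\<alpha> b)) \<noteq> 0"
    by (auto simp: ratio_def split: if_splits)
  have "(\<Sum>t\<in>T - {s}. c t * ?\<alpha> t x) = 0" for x
  proof -
    have "(\<Sum>t\<in>T. c t * ?\<alpha> t x) = 0"
      using proj_sum[where w = "\<alpha> b" and T = T and c = c and \<alpha> = \<alpha>] Cons.prems(3) by (simp add: fun_eq_iff proj_def)
    then show ?thesis using s' Cons.prems(2) s(1) by (simp add: sum.remove)
  qed
  then have IH: "c t = 0" if "t \<in> T - {s}" for t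
    using Cons.IH[OF s(3), of t] that Cons.prems(2) by blast
  have "(\<Sum>t\<in>T. c t * \<alpha> t (pivot (\<alpha> b))) = c s * \<alpha> s (pivot (\<alpha> b))"
    using Cons.prems(2) s(1) IH by (simp add: sum.remove)
  then have "c s = 0" using Cons.prems(3) s'(2) by simp
  then show ?case using IH Cons.prems(4) by blast
qed

lemma residue_dependent:
  assumes "finite T" "\<And>x. (\<Sum>t\<in>T. c t * \<alpha> t x) = 0" "t \<in> T" "c t \<noteq> 0"
  shows "residue \<alpha> bs T = 0"
  using residue_nonzero_imp_independent assms by blast

lemma residue_insert:
  assumes "finite T" "t \<notin> T"
  shows "residue \<alpha> (b # bs) (insert t T) =
      ratio (\<alpha> b) (\<alpha> t) * residue (\<lambda>t. proj (\<alpha> b) (\<alpha> t)) bs T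
    + (\<Sum>s\<in>T. ratio (\<alpha> b) (\<alpha> s) * residue (\<lambda>t. proj (\<alpha> b) (\<alpha> t)) bs (insert t (T - {s})))"
proof -
  have "insert t T - {s} = insert t (T - {s})" if "s \<in> T" for s using assms that by auto
  moreover have "insert t T - {t} = T" using assms by auto
  ultimately show ?thesis using assms by (simp add: sum.insert)
qed

lemma residue_flip:
  assumes "finite T" "t \<notin> T" "t' \<notin> T" "\<alpha> t = (\<lambda>x. - \<alpha> t' x)"
  shows "residue \<alpha> bs (insert t T) = - residue \<alpha> bs (insert t' T)"
  using assms
proof (induction bs arbitrary: \<alpha> T)
  case Nil
  then show ?case by simp
next
  case (Cons b bs)
  let ?\<alpha> = "\<lambda>t. proj (\<alpha> b) (\<alpha> t)"
  have "residue ?\<alpha> bs (insert t (T - {s})) = - residue ?\<alpha> bs (insert t' (T - {s}))" for s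
    using Cons.prems by (intro Cons.IH) (auto simp: proj_uminus)
  then show ?case
    unfolding residue_insert[OF Cons.prems(1,2)] residue_insert[OF Cons.prems(1,3)]
    by (simp add: Cons.prems(4) ratio_uminus sum_negf)
qed

text \<open>The first step \<open>b\<close> either removes an element of \<open>T\<close>, where the
  induction hypothesis applies, or one of \<open>p\<close>, \<open>q\<close>, \<open>r\<close>. In
  the latter case the removed vector projects to 0, so the other two become opposite and their two
  terms cancel by \<open>residue_flip\<close>.\<close>

lemma residue_three_term:
  assumes "finite T" "p \<notin> T" "q \<notin> T" "r \<notin> T" "p \<noteq> q" "q \<noteq> r" "p \<noteq> r"
    and "\<And>x. \<alpha> p x + \<alpha> q x + \<alpha> r x = 0"
  shows "residue \<alpha> bs (insert p (insert q T)) + residue \<alpha> bs (insert q (insert r T))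
    + residue \<alpha> bs (insert r (insert p T)) = 0"
  using assms
proof (induction bs arbitrary: \<alpha> T)
  case Nil
  then show ?case by simp
next
  case (Cons b bs)
  let ?\<alpha> = "\<lambda>t. proj (\<alpha> b) (\<alpha> t)"
  let ?R = "residue ?\<alpha> bs" and ?e = "\<lambda>t. ratio (\<alpha> b) (\<alpha> t)"
  have sum0: "?\<alpha> p x + ?\<alpha> q x + ?\<alpha> r x = 0" for x
  proof -
    let ?k = "pivot (\<alpha> b)"
    have "?\<alpha> p x + ?\<alpha> q x + ?\<alpha> r x = (\<alpha> p x + \<alpha> q x + \<alpha> r x)
        - (\<alpha> p ?k + \<alpha> q ?k + \<alpha> r ?k) / \<alpha> b ?k * \<alpha> b x"
      by (simp add: proj_def add_divide_distrib algebra_simps)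
    then show ?thesis using Cons.prems(8) by simp
  qed
  have two: "residue \<alpha> (b # bs) (insert y (insert z T)) = 
      ?e y * ?R (insert z T) + ?e z * ?R (insert y T) + (\<Sum>s\<in>T. ?e s * ?R (insert y (insert z (T - {s}))))"
    if "y \<notin> T" "z \<notin> T" "y \<noteq> z" for y z
  proof -
    have "insert z T - {s} = insert z (T - {s})" if "s \<in> T" for s
      using that \<open>z \<notin> T\<close> by auto
    moreover have "insert z T - {z} = T" using \<open>z \<notin> T\<close> by auto
    ultimately show ?thesis
      using that Cons.prems(1) by (subst residue_insert) (auto simp: sum.insert)
  qed
  have opp: "?e y * (?R (insert z T) + ?R (insert w T)) = 0"
    if "z \<notin> T" "w \<notin> T" "\<And>x. ?\<alpha> y x + ?\<alpha> z x + ?\<alpha> w x = 0" for y z w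
  proof (cases "?e y = 0")
    case False
    then have "?\<alpha> y = (\<lambda>_. 0)" by (auto simp: ratio_def split: if_splits)
    then have "?\<alpha> z = (\<lambda>x. - ?\<alpha> w x)"
      using that(3) by (auto simp: fun_eq_iff eq_neg_iff_add_eq_0)
    then show ?thesis using residue_flip[of T z w ?\<alpha> bs] that Cons.prems(1) by simp
  qed simp
  have "(\<Sum>s\<in>T. ?e s * ?R (insert p (insert q (T - {s})))) + (\<Sum>s\<in>T. ?e s * ?R (insert q (insert r (T - {s}))))
     + (\<Sum>s\<in>T. ?e s * ?R (insert r (insert p (T - {s})))) = 0"
    unfolding sum.distrib[symmetric] distrib_left[symmetric]
  proof (intro sum.neutral ballI)
    fix s
    have "?R (insert p (insert q (T - {s}))) + ?R (insert q (insert r (T - {s})))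
        + ?R (insert r (insert p (T - {s}))) = 0"
      by (rule Cons.IH) (use Cons.prems(1-7) sum0 in auto)
    then show "?e s * (?R (insert p (insert q (T - {s}))) + ?R (insert q (insert r (T - {s})))
        + ?R (insert r (insert p (T - {s})))) = 0" by simp
  qed
  moreover have "?e p * (?R (insert q T) + ?R (insert r T)) = 0"
    "?e q * (?R (insert r T) + ?R (insert p T)) = 0"
    "?e r * (?R (insert p T) + ?R (insert q T)) = 0"
    by (intro opp; use sum0 Cons.prems in \<open>simp add: add_ac\<close>)+
  ultimately show ?case
    using Cons.prems by (subst (1 2 3) two) (auto simp: algebra_simps)
qed

section \<open>Sets without broken circuits\<close>

definition in_span :: "(edge \<Rightarrow> vec) \<Rightarrow> edge set \<Rightarrow> vec \<Rightarrow> bool" where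
  "in_span \<alpha> S v \<longleftrightarrow> (\<exists>c. \<forall>x. v x = (\<Sum>s\<in>S. c s * \<alpha> s x))"

text \<open>A broken circuit is a circuit without its smallest element \<open>e\<close>, so \<open>S\<close> contains one iff some \<open>\<alpha> e\<close>
  is spanned by the larger elements. Dependent sets \<open>S \<subseteq> E\<close> are excluded as well. The set \<open>S\<close> need not be
  contained in \<open>E\<close>, which makes the notion stable under contraction.\<close>
definition nbc :: "(edge \<Rightarrow> vec) \<Rightarrow> edge set \<Rightarrow> edge set \<Rightarrow> bool" where
  "nbc \<alpha> E S \<longleftrightarrow> (\<forall>e\<in>E. \<not> in_span \<alpha> {s \<in> S. prod_encode e < prod_encode s} (\<alpha> e))"

lemma in_span_proj:
  assumes "in_span (\<lambda>t. proj (\<alpha> b) (\<alpha> t)) S (proj (\<alpha> b) v)" "finite S" "b \<notin> S"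
  shows "in_span \<alpha> (insert b S) v"
proof -
  from assms(1) obtain c where c: "\<And>x. proj (\<alpha> b) v x = (\<Sum>s\<in>S. c s * proj (\<alpha> b) (\<alpha> s) x)"
    unfolding in_span_def by blast
  let ?k = "pivot (\<alpha> b)"
  let ?f = "\<lambda>v. v ?k / \<alpha> b ?k"
  \<comment> \<open>The coefficient of \<open>b\<close> collects the multiples of
    \<open>\<alpha> b\<close> that the projections have subtracted from \<open>v\<close> and from
    the vectors of \<open>S\<close>.\<close>
  let ?c = "c(b := ?f v - (\<Sum>s\<in>S. c s * ?f (\<alpha> s)))"
  have "v x = (\<Sum>s\<in>insert b S. ?c s * \<alpha> s x)" for x
  proof -
    have "(\<Sum>s\<in>insert b S. ?c s * \<alpha> s x) = ?c b * \<alpha> b x + (\<Sum>s\<in>S. c s * \<alpha> s x)"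
      using assms(2,3) by (simp add: sum.insert) (intro sum.cong, auto)
    moreover have "v x = ?f v * \<alpha> b x + (\<Sum>s\<in>S. c s * \<alpha> s x) - (\<Sum>s\<in>S. c s * ?f (\<alpha> s)) * \<alpha> b x"
      using c[of x] unfolding proj_def by (simp add: algebra_simps sum_subtractf sum_distrib_left)
    ultimately show ?thesis by (simp add: algebra_simps)
  qed
  then show ?thesis unfolding in_span_def by blast
qed

lemma in_span_mono:
  assumes "in_span \<alpha> S v" "S \<subseteq> S'" "finite S'"
  shows "in_span \<alpha> S' v"
proof -
  from assms(1) obtain c where c: "\<And>x. v x = (\<Sum>s\<in>S. c s * \<alpha> s x)"
    unfolding in_span_def by blast
  have "(\<Sum>s\<in>S. c s * \<alpha> s x) = (\<Sum>s\<in>S'. (if s \<in> S then c s else 0) * \<alpha> s x)" for x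
    using assms(2,3) by (intro sum.mono_neutral_cong_left) auto
  with c show ?thesis unfolding in_span_def by metis
qed

text \<open>For \<open>e\<close> below \<open>b\<close>, the element \<open>b\<close> is itself
  among the larger elements of \<open>S\<close>. A span relation after contraction lifts to one that
  also uses \<open>b\<close>, hence still only elements above \<open>e\<close>.\<close>

lemma nbc_contract:
  assumes "nbc \<alpha> E S" "finite S" "b \<in> S"
  shows "nbc (\<lambda>t. proj (\<alpha> b) (\<alpha> t)) {e\<in>E. prod_encode e < prod_encode b} (S - {b})"
  unfolding nbc_def
proof (intro ballI notI)
  fix e assume e: "e \<in> {e\<in>E. prod_encode e < prod_encode b}"
    and sp: "in_span (\<lambda>t. proj (\<alpha> b) (\<alpha> t)) {s \<in> S - {b}. prod_encode e < prod_encode s} (proj (\<alpha> b) (\<alpha> e))"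
  have "in_span \<alpha> (insert b {s \<in> S - {b}. prod_encode e < prod_encode s}) (\<alpha> e)"
    using sp assms(2) by (intro in_span_proj) auto
  moreover have "insert b {s \<in> S - {b}. prod_encode e < prod_encode s} = {s \<in> S. prod_encode e < prod_encode s}"
    using e assms(3) by auto
  ultimately show False using assms(1) e unfolding nbc_def by auto
qed

lemma in_span_singleton: "in_span \<alpha> {t} v \<longleftrightarrow> (\<exists>k. \<forall>x. v x = k * \<alpha> t x)"
proof
  assume "\<exists>k. \<forall>x. v x = k * \<alpha> t x"
  then obtain k where "\<forall>x. v x = k * \<alpha> t x" by blast
  then show "in_span \<alpha> {t} v"
    unfolding in_span_def by (intro exI[of _ "\<lambda>_. k"]) simp
qed (auto simp: in_span_def)

lemma ratio_nonzero_span: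
  assumes "ratio w (\<alpha> t) \<noteq> 0"
  shows "in_span \<alpha> {t} w" "\<alpha> b = w \<Longrightarrow> in_span \<alpha> {b} (\<alpha> t)"
proof -
  from assms have *: "proj w (\<alpha> t) = (\<lambda>_. 0)" "\<alpha> t (pivot w) \<noteq> 0" "w (pivot w) \<noteq> 0"
    by (auto simp: ratio_def split: if_splits)
  from *(1) have eq: "\<alpha> t x = \<alpha> t (pivot w) / w (pivot w) * w x" for x
    using fun_cong[OF *(1), of x] unfolding proj_def by linarith
  have "w x = w (pivot w) / \<alpha> t (pivot w) * \<alpha> t x" for x
    by (subst eq) (use *(2,3) in simp)
  then show "in_span \<alpha> {t} w"
    unfolding in_span_singleton by blast
  show "in_span \<alpha> {b} (\<alpha> t)" if "\<alpha> b = w"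
    unfolding in_span_singleton that using eq by blast
qed

text \<open>The head \<open>b\<close> is the largest element of \<open>bs\<close>. A smaller
  \<open>t\<close> in \<open>T\<close> parallel to \<open>b\<close> would contradict
  \<open>nbc\<close> of \<open>set bs\<close>, a larger one \<open>nbc\<close> of \<open>T\<close>,
  so \<open>b\<close> can remove only itself. After contraction the ambient set shrinks to the
  elements below \<open>b\<close>, although \<open>T\<close> may contain larger ones; the last
  hypothesis is the invariant that admits these.\<close>

lemma residue_nbc:
  assumes "sorted_wrt (\<lambda>x y. prod_encode y < prod_encode x) bs" "set bs \<subseteq> E"
    and "nbc \<alpha> E (set bs)" "nbc \<alpha> E T" "finite T"
    and "\<And>t. t \<in> T \<Longrightarrow> t \<in> E \<or> (\<forall>b\<in>set bs. prod_encode b < prod_encode t)"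
  shows "residue \<alpha> bs T = (if T = set bs then 1 else 0)"
  using assms
proof (induction bs arbitrary: \<alpha> E T)
  case Nil
  then show ?case by simp
next
  case (Cons b bs)
  let ?\<alpha> = "\<lambda>t. proj (\<alpha> b) (\<alpha> t)"
  have only_b: "ratio (\<alpha> b) (\<alpha> t) = 0" if "t \<in> T" "t \<noteq> b" for t
  proof (rule ccontr)
    assume nz: "ratio (\<alpha> b) (\<alpha> t) \<noteq> 0"
    have "prod_encode t \<noteq> prod_encode b" using that(2) by simp
    then consider "prod_encode t < prod_encode b" | "prod_encode b < prod_encode t" by linarith
    then show False
    proof cases
      case 1
      then have "t \<in> E" using Cons.prems(6)[OF that(1)] by auto
      moreover have "in_span \<alpha> {s \<in> set (b # bs). prod_encode t < prod_encode s} (\<alpha> t)"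
        by (rule in_span_mono[OF ratio_nonzero_span(2)[where b = b and \<alpha> = \<alpha> and t = t, OF nz refl]]) (use 1 in auto)
      ultimately show False using Cons.prems(3) unfolding nbc_def by blast
    next
      case 2
      have "in_span \<alpha> {s \<in> T. prod_encode b < prod_encode s} (\<alpha> b)"
        by (rule in_span_mono[OF ratio_nonzero_span(1)[where \<alpha> = \<alpha> and t = t, OF nz]]) (use 2 that(1) Cons.prems(5) in auto)
      then show False using Cons.prems(2,4) unfolding nbc_def by auto
    qed
  qed
  show ?case
  proof (cases "b \<in> T")
    case False
    then have "residue \<alpha> (b # bs) T = 0" using only_b by (metis (no_types, lifting) mult_eq_0_iff residue.simps(2) sum.neutral)
    then show ?thesis using False by auto
  next
    case True
    have bs: "b \<notin> set bs" using Cons.prems(1) by auto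
    have "\<alpha> b \<noteq> (\<lambda>_. 0)"
    proof
      assume "\<alpha> b = (\<lambda>_. 0)"
      then have "in_span \<alpha> {s \<in> T. prod_encode b < prod_encode s} (\<alpha> b)"
        unfolding in_span_def by (intro exI[of _ "\<lambda>_. 0"]) auto
      then show False using Cons.prems(2,4) unfolding nbc_def by auto
    qed
    then have "residue \<alpha> (b # bs) T = residue ?\<alpha> bs (T - {b})"
      using True only_b Cons.prems(5) by (simp add: sum.remove ratio_self sum.neutral)
    also have "\<dots> = (if T - {b} = set bs then 1 else 0)"
    proof (rule Cons.IH[of "{e\<in>E. prod_encode e < prod_encode b}"])
      show "nbc ?\<alpha> {e\<in>E. prod_encode e < prod_encode b} (set bs)"
        using nbc_contract[OF Cons.prems(3), of b] bs by simp
      show "nbc ?\<alpha> {e\<in>E. prod_encode e < prod_encode b} (T - {b})"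
        using nbc_contract[OF Cons.prems(4,5) True] .
      fix t assume t: "t \<in> T - {b}"
      then have "prod_encode t \<noteq> prod_encode b" by simp
      then show "t \<in> {e\<in>E. prod_encode e < prod_encode b} \<or> (\<forall>b\<in>set bs. prod_encode b < prod_encode t)"
        using Cons.prems(6)[of t] Cons.prems(1) t by fastforce
    qed (use Cons.prems in auto)
    also have "(T - {b} = set bs) = (T = set (b # bs))" using True bs by auto
    finally show ?thesis .
  qed
qed

section \<open>Functionals on the Fomin--Kirillov algebra\<close>

definition nc_mono :: "edge list \<Rightarrow> ncpoly" where
  "nc_mono u = (\<lambda>w. if w = u then 1 else 0)"

lemma pr_nc_mono: "pr (nc_mono u) \<mu> = \<mu> u"
  unfolding nc_mono_def by (rule pr_indicator)

lemma nc_over_mono: "set u \<subseteq> V \<Longrightarrow> nc_over V (nc_mono u)"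
  by (auto simp: nc_over_def nc_fin_def nc_mono_def)

lemma nc_fin_mono: "nc_fin (nc_mono u)"
  by (auto simp: nc_fin_def nc_mono_def)

lemma nc_fin_var: "nc_fin (nc_var i j)"
  by (auto simp: nc_fin_def nc_var_def)

lemma nc_fin_add: "nc_fin p \<Longrightarrow> nc_fin q \<Longrightarrow> nc_fin (nc_add p q)"
  unfolding nc_fin_def nc_add_def
  by (rule finite_subset[of _ "{w. p w \<noteq> 0} \<union> {w. q w \<noteq> 0}"]) auto

lemma nc_fin_sub: "nc_fin p \<Longrightarrow> nc_fin q \<Longrightarrow> nc_fin (nc_sub p q)"
  unfolding nc_fin_def nc_sub_def
  by (rule finite_subset[of _ "{w. p w \<noteq> 0} \<union> {w. q w \<noteq> 0}"]) auto

lemma nc_fin_comm: "nc_fin p \<Longrightarrow> nc_fin q \<Longrightarrow> nc_fin (nc_comm p q)"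
  unfolding nc_comm_def by (intro nc_fin_sub nc_fin_mul)

lemma nc_over_fin: "nc_over V p \<Longrightarrow> nc_fin p"
  by (simp add: nc_over_def)

lemma pr_nc_var: "pr (nc_var i j) \<mu> = \<mu> [(i, j)]"
  unfolding nc_var_def by (rule pr_indicator)

lemma pr_nc_add: "nc_fin p \<Longrightarrow> nc_fin q \<Longrightarrow> pr (nc_add p q) \<mu> = pr p \<mu> + pr q \<mu>"
  unfolding nc_add_def nc_fin_def by (rule pr_add)

lemma pr_nc_sub: "nc_fin p \<Longrightarrow> nc_fin q \<Longrightarrow> pr (nc_sub p q) \<mu> = pr p \<mu> - pr q \<mu>"
  unfolding nc_sub_def nc_fin_def by (rule pr_sub)

lemmas nc_fin_intros = nc_fin_mono nc_fin_var nc_fin_add nc_fin_sub nc_fin_mul nc_fin_comm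

lemma nc_ideal_fin:
  assumes "p \<in> nc_ideal V S" "\<And>s. s \<in> S \<Longrightarrow> nc_fin s"
  shows "nc_fin p"
  using assms(1)
  by induction (auto simp: nc_zero_def nc_fin_def[of "\<lambda>_. 0"] assms(2) nc_over_fin intro!: nc_fin_intros)

text \<open>The context \<open>u\<close>, \<open>v\<close> is general because multiplication inside
  the ideal turns into a longer context. \<open>nc_ideal_context\<close> is the converse.\<close>

lemma nc_ideal_kill:
  assumes p: "p \<in> nc_ideal V S" and S: "\<And>s. s \<in> S \<Longrightarrow> nc_fin s"
    and kill: "\<And>s u v. s \<in> S \<Longrightarrow> set u \<subseteq> V \<Longrightarrow> set v \<subseteq> V \<Longrightarrow> pr s (\<lambda>w. \<mu> (u @ w @ v)) = 0"
    and "set u \<subseteq> V" "set v \<subseteq> V"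
  shows "pr p (\<lambda>w. \<mu> (u @ w @ v)) = 0"
  using p assms(4,5)
proof (induction arbitrary: u v)
  case zero
  then show ?case by (simp add: pr_def nc_zero_def)
next
  case (gen s)
  then show ?case using kill by blast
next
  case (add p q)
  then show ?case using nc_ideal_fin[of _ V S] S by (subst pr_nc_add) auto
next
  case (mul p a b)
  have fin: "nc_fin p" "nc_fin a" "nc_fin b"
    using nc_ideal_fin[OF mul.hyps(1)] S mul.hyps by (auto intro: nc_over_fin)
  have "pr (nc_mul (nc_mul a p) b) (\<lambda>w. \<mu> (u @ w @ v))
      = pr a (\<lambda>x. pr p (\<lambda>y. pr b (\<lambda>z. \<mu> ((u @ x) @ y @ (z @ v)))))"
    using fin by (simp add: pr_nc_mul nc_fin_mul)
  also have "\<dots> = pr a (\<lambda>x. pr b (\<lambda>z. pr p (\<lambda>y. \<mu> ((u @ x) @ y @ (z @ v)))))"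
    by (subst pr_commute) (rule refl)
  also have "\<dots> = 0"
    using mul.hyps mul.prems by (intro pr_eq_0 mul.IH) (auto simp: nc_over_def)
  finally show ?case .
qed

lemma nc_ideal_context:
  assumes kill: "\<And>p. p \<in> nc_ideal V S \<Longrightarrow> pr p \<mu> = 0"
    and s: "s \<in> S" "nc_fin s" and "set u \<subseteq> V" "set v \<subseteq> V"
  shows "pr s (\<lambda>w. \<mu> (u @ w @ v)) = 0"
proof -
  have "nc_mul (nc_mul (nc_mono u) s) (nc_mono v) \<in> nc_ideal V S"
    using assms by (intro nc_ideal.mul nc_ideal.gen nc_over_mono)
  from kill[OF this] show ?thesis
    using s by (simp add: pr_nc_mul pr_nc_mono nc_fin_mul nc_fin_mono)
qed

text \<open>By \<open>FK_functional_kill\<close> and \<open>FK_functionalI\<close> these are exactly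
  the functionals vanishing on \<open>FK_ideal n\<close>. Testing generators between words leaves
  finitely many explicit values per relation.\<close>

definition FK_functional :: "nat \<Rightarrow> (edge list \<Rightarrow> rat) \<Rightarrow> bool" where
  "FK_functional n \<mu> \<longleftrightarrow> (\<forall>s u v. s \<in> FK_rels n \<longrightarrow> set u \<subseteq> FK_vars n \<longrightarrow> set v \<subseteq> FK_vars n \<longrightarrow>
     pr s (\<lambda>w. \<mu> (u @ w @ v)) = 0)"

lemma FK_rels_fin: "s \<in> FK_rels n \<Longrightarrow> nc_fin s"
  unfolding FK_rels_def by (auto intro!: nc_fin_intros)

lemma FK_functional_kill: "FK_functional n \<mu> \<Longrightarrow> p \<in> FK_ideal n \<Longrightarrow> pr p \<mu> = 0"
  using nc_ideal_kill[of p "FK_vars n" "FK_rels n" \<mu> "[]" "[]"] FK_rels_fin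
  unfolding FK_functional_def FK_ideal_def by simp

lemma FK_functionalI:
  assumes "\<And>p. p \<in> FK_ideal n \<Longrightarrow> pr p \<mu> = 0"
  shows "FK_functional n \<mu>"
  using assms nc_ideal_context[of "FK_vars n" "FK_rels n" \<mu>] FK_rels_fin
  unfolding FK_functional_def FK_ideal_def by blast

lemma pr_FK_rels:
  "pr (nc_add (nc_var i j) (nc_var k l)) \<mu> = \<mu> [(i,j)] + \<mu> [(k,l)]"
  "pr (nc_mul (nc_var i j) (nc_var k l)) \<mu> = \<mu> [(i,j),(k,l)]"
  "pr (nc_comm (nc_var i j) (nc_var k l)) \<mu> = \<mu> [(i,j),(k,l)] - \<mu> [(k,l),(i,j)]"
  "pr (nc_add (nc_add (nc_mul (nc_var i j) (nc_var j k)) (nc_mul (nc_var j k) (nc_var k i)))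
             (nc_mul (nc_var k i) (nc_var i j))) \<mu> =
   \<mu> [(i,j),(j,k)] + \<mu> [(j,k),(k,i)] + \<mu> [(k,i),(i,j)]"
  by (simp_all add: pr_nc_add pr_nc_sub nc_comm_def pr_nc_mul pr_nc_var nc_fin_intros)

lemma FK_functional_iff:
  "FK_functional n \<mu> \<longleftrightarrow> (\<forall>u v. set u \<subseteq> FK_vars n \<longrightarrow> set v \<subseteq> FK_vars n \<longrightarrow>
     (\<forall>i j. (i, j) \<in> FK_vars n \<longrightarrow> \<mu> (u @ (i,j) # v) + \<mu> (u @ (j,i) # v) = 0) \<and>
     (\<forall>i j. (i, j) \<in> FK_vars n \<longrightarrow> \<mu> (u @ (i,j) # (i,j) # v) = 0) \<and>
     (\<forall>i j k l. i \<in> {1..n} \<longrightarrow> j \<in> {1..n} \<longrightarrow> k \<in> {1..n} \<longrightarrow> l \<in> {1..n} \<longrightarrow> distinct [i,j,k,l] \<longrightarrow>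
        \<mu> (u @ (i,j) # (k,l) # v) = \<mu> (u @ (k,l) # (i,j) # v)) \<and>
     (\<forall>i j k. i \<in> {1..n} \<longrightarrow> j \<in> {1..n} \<longrightarrow> k \<in> {1..n} \<longrightarrow> distinct [i,j,k] \<longrightarrow>
        \<mu> (u @ (i,j) # (j,k) # v) + \<mu> (u @ (j,k) # (k,i) # v) + \<mu> (u @ (k,i) # (i,j) # v) = 0))"
  (is "?L \<longleftrightarrow> ?R")
proof
  assume L: ?L
  have *: "pr s (\<lambda>w. \<mu> (u @ w @ v)) = 0" if "s \<in> FK_rels n" "set u \<subseteq> FK_vars n" "set v \<subseteq> FK_vars n" for s u v
    using L that unfolding FK_functional_def by blast
  show ?R
  proof (intro allI impI conjI, goal_cases)
    case (1 u v i j)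
    have "nc_add (nc_var i j) (nc_var j i) \<in> FK_rels n" using 1 unfolding FK_rels_def by blast
    from *[OF this 1(1,2)] show ?case by (simp add: pr_FK_rels)
  next
    case (2 u v i j)
    have "nc_mul (nc_var i j) (nc_var i j) \<in> FK_rels n" using 2 unfolding FK_rels_def by blast
    from *[OF this 2(1,2)] show ?case by (simp add: pr_FK_rels)
  next
    case (3 u v i j k l)
    have "nc_comm (nc_var i j) (nc_var k l) \<in> FK_rels n" using 3 unfolding FK_rels_def by blast
    from *[OF this 3(1,2)] show ?case by (simp add: pr_FK_rels)
  next
    case (4 u v i j k)
    have "nc_add (nc_add (nc_mul (nc_var i j) (nc_var j k)) (nc_mul (nc_var j k) (nc_var k i)))
             (nc_mul (nc_var k i) (nc_var i j)) \<in> FK_rels n" using 4 unfolding FK_rels_def by blast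
    from *[OF this 4(1,2)] show ?case by (simp add: pr_FK_rels)
  qed
next
  assume R: ?R
  then show ?L
    unfolding FK_functional_def FK_rels_def by (auto simp: pr_FK_rels)
qed

lemma FK_flip:
  "FK_functional n \<mu> \<Longrightarrow> set u \<subseteq> FK_vars n \<Longrightarrow> set v \<subseteq> FK_vars n \<Longrightarrow> (i, j) \<in> FK_vars n \<Longrightarrow>
    \<mu> (u @ (j,i) # v) = - \<mu> (u @ (i,j) # v)"
  unfolding FK_functional_iff by (simp add: eq_neg_iff_add_eq_0 add.commute)

lemma FK_square:
  "FK_functional n \<mu> \<Longrightarrow> set u \<subseteq> FK_vars n \<Longrightarrow> set v \<subseteq> FK_vars n \<Longrightarrow> (i, j) \<in> FK_vars n \<Longrightarrow>
    \<mu> (u @ (i,j) # (i,j) # v) = 0"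
  unfolding FK_functional_iff by simp

lemma FK_swap:
  "FK_functional n \<mu> \<Longrightarrow> set u \<subseteq> FK_vars n \<Longrightarrow> set v \<subseteq> FK_vars n \<Longrightarrow> (i, j) \<in> FK_vars n \<Longrightarrow>
    (k, l) \<in> FK_vars n \<Longrightarrow> {i, j} \<inter> {k, l} = {} \<Longrightarrow>
    \<mu> (u @ (i,j) # (k,l) # v) = \<mu> (u @ (k,l) # (i,j) # v)"
  unfolding FK_functional_iff by (simp add: FK_vars_def)

lemma FK_triangle:
  "FK_functional n \<mu> \<Longrightarrow> set u \<subseteq> FK_vars n \<Longrightarrow> set v \<subseteq> FK_vars n \<Longrightarrow> i \<in> {1..n} \<Longrightarrow> j \<in> {1..n} \<Longrightarrow>
    k \<in> {1..n} \<Longrightarrow> distinct [i,j,k] \<Longrightarrow>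
    \<mu> (u @ (i,j) # (j,k) # v) + \<mu> (u @ (j,k) # (k,i) # v) + \<mu> (u @ (k,i) # (i,j) # v) = 0"
  unfolding FK_functional_iff by simp

lemma FK_move:
  assumes "FK_functional n \<mu>" "set u \<subseteq> FK_vars n" "set v \<subseteq> FK_vars n" "set w \<subseteq> FK_vars n" "(i, j) \<in> FK_vars n"
    and "\<And>k l. (k, l) \<in> set w \<Longrightarrow> {i, j} \<inter> {k, l} = {}"
  shows "\<mu> (u @ w @ (i,j) # v) = \<mu> (u @ (i,j) # w @ v)"
  using assms(2-)
proof (induction w arbitrary: u)
  case (Cons e w)
  obtain k l where e: "e = (k, l)" by fastforce
  have "\<mu> (u @ (e # w) @ (i,j) # v) = \<mu> ((u @ [e]) @ w @ (i,j) # v)" by simp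
  also have "\<dots> = \<mu> ((u @ [e]) @ (i,j) # w @ v)"
    using Cons.prems by (intro Cons.IH) auto
  also have "\<dots> = \<mu> (u @ (k,l) # (i,j) # w @ v)" by (simp add: e)
  also have "\<dots> = \<mu> (u @ (i,j) # (k,l) # w @ v)"
    using Cons.prems(5)[of k l] e Cons.prems by (intro FK_swap[OF assms(1)]) auto
  finally show ?case by (simp add: e)
qed simp

section \<open>The cycle relation in the Fomin--Kirillov algebra\<close>

fun path :: "nat list \<Rightarrow> edge list" where
  "path (a # b # vs) = (a, b) # path (b # vs)"
| "path _ = []"

lemma path_append:
  "vs \<noteq> [] \<Longrightarrow> ws \<noteq> [] \<Longrightarrow> path (vs @ ws) = path vs @ (last vs, hd ws) # path ws"
  by (induction vs rule: path.induct) (auto simp: neq_Nil_conv)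

lemma path_vertices: "(a, b) \<in> set (path vs) \<Longrightarrow> a \<in> set vs \<and> b \<in> set vs"
  by (induction vs rule: path.induct) auto

lemma path_FK_vars: "distinct vs \<Longrightarrow> set vs \<subseteq> {1..n} \<Longrightarrow> set (path vs) \<subseteq> FK_vars n"
  by (induction vs rule: path.induct) (auto simp: FK_vars_def)

lemma sum_lessThan_shift_last:
  "(\<Sum>i<Suc (Suc m). f i) = f 0 + (\<Sum>i\<in>{1..m}. f i) + (f (Suc m) :: rat)"
  unfolding sum.lessThan_Suc[of _ "Suc m"] sum.lessThan_Suc_shift[of _ m]
  by (simp add: sum.atLeast1_atMost_eq lessThan_atLeast0 sum.atLeast_Suc_atMost_Suc_shift[symmetric] del: sum.lessThan_Suc)

text \<open>Induction on the length of the cycle: the triangle relation at the last vertex \<open>b\<close> of the cycle turns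
  \<open>x(l,b) x(b,h)\<close> into \<open>x(b,h) x(l,h) + x(l,h) x(l,b)\<close>, and the outer factors \<open>x(b,h)\<close> and \<open>x(l,b)\<close> commute
  past the remaining ones to the two ends of the word.\<close>
lemma FK_cycle:
  assumes "FK_functional n \<mu>" "set u \<subseteq> FK_vars n" "set v \<subseteq> FK_vars n"
    and "distinct vs" "set vs \<subseteq> {1..n}" "length vs = Suc (Suc m)"
  shows "(\<Sum>i<Suc (Suc m). \<mu> (u @ path (drop i vs @ take i vs) @ v)) = 0"
  using assms(2-)
proof (induction m arbitrary: u v vs)
  \<comment> \<open>For a cycle with two vertices the relation is antisymmetry of the
    variable.\<close>
  case 0
  then obtain a b where ab: "vs = [a, b]"
    by (auto simp: length_Suc_conv)
  show ?case using FK_flip[OF assms(1) 0(1,2), of a b] 0 ab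
    by (auto simp: FK_vars_def)
next
  case (Suc m)
  from Suc.prems(5) obtain ws b where vs: "vs = ws @ [b]" and len: "length ws = Suc (Suc m)"
    by (metis length_Suc_conv_rev)
  define h l where "h = hd ws" and "l = last ws"
  have ws: "ws \<noteq> []" "distinct ws" "b \<notin> set ws" "set ws \<subseteq> {1..n}" "b \<in> {1..n}"
    using Suc.prems vs len by auto
  have hl: "h \<in> set ws" "l \<in> set ws" "h \<noteq> l"
  proof -
    obtain x y zs where xyz: "ws = x # y # zs" using len by (auto simp: length_Suc_conv)
    have "last (y # zs) \<in> set (y # zs)" by (rule last_in_set) simp
    then show "h \<in> set ws" "l \<in> set ws" "h \<noteq> l"
      using ws(2) unfolding h_def l_def xyz by (auto split: if_splits)
  qed
  have in_vars: "(b, h) \<in> FK_vars n" "(l, b) \<in> FK_vars n" "(l, h) \<in> FK_vars n" "(h, l) \<in> FK_vars n"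
    using hl ws by (auto simp: FK_vars_def)
  let ?T = "\<lambda>u v i. \<mu> (u @ path (drop i ws @ take i ws) @ v)"
  let ?S = "\<lambda>i. \<mu> (u @ path (drop i vs @ take i vs) @ v)"
  have IH: "?T u v 0 + (\<Sum>i\<in>{1..m}. ?T u v i) + ?T u v (Suc m) = 0"
    if "set u \<subseteq> FK_vars n" "set v \<subseteq> FK_vars n" for u v
    using Suc.IH[OF that ws(2,4) len] unfolding sum_lessThan_shift_last .
  have mid: "?S i = ?T (u @ [(b, h)]) v i + ?T u ((l, b) # v) i" if i: "i \<in> {1..Suc m}" for i
  proof -
    let ?X = "path (drop i ws)" and ?Y = "path (take i ws)"
    have ne: "drop i ws \<noteq> []" "take i ws \<noteq> []" using i len by auto
    have lh: "last (drop i ws) = l" "hd (take i ws) = h"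
      using i len by (auto simp: l_def h_def last_drop hd_take)
    have X: "set ?X \<subseteq> FK_vars n" and Y: "set ?Y \<subseteq> FK_vars n"
      using ws set_drop_subset[of i ws] set_take_subset[of i ws] by (intro path_FK_vars; simp)+
    have hX: "h \<notin> set (drop i ws)"
    proof -
      have "h \<in> set (take i ws)" using ne(2) lh(2) by (metis hd_in_set)
      then show ?thesis using ws(2) by (metis append_take_drop_id disjoint_iff distinct_append)
    qed
    have lY: "l \<notin> set (take i ws)"
    proof -
      have "l \<in> set (drop i ws)" using ne(1) lh(1) by (metis last_in_set)
      then show ?thesis using ws(2) by (metis append_take_drop_id disjoint_iff distinct_append)
    qed
    have bXY: "b \<notin> set (drop i ws)" "b \<notin> set (take i ws)"
      using ws(3) by (auto dest: in_set_dropD in_set_takeD)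
    have p: "path (drop i ws @ take i ws) = ?X @ (l, h) # ?Y"
      using path_append[OF ne] lh by simp
    have "path (drop i vs @ take i vs) = path ((drop i ws @ [b]) @ take i ws)"
      using i len vs by simp
    also have "\<dots> = ?X @ (l, b) # (b, h) # ?Y"
      using path_append[of "drop i ws @ [b]" "take i ws"] path_append[of "drop i ws" "[b]"] ne lh by simp
    finally have 1: "?S i = \<mu> ((u @ ?X) @ (l, b) # (b, h) # ?Y @ v)" by simp
    have uX: "set (u @ ?X) \<subseteq> FK_vars n" and Yv: "set (?Y @ v) \<subseteq> FK_vars n"
      using Suc.prems X Y by auto
    have 2: "\<mu> ((u @ ?X) @ (l, b) # (b, h) # ?Y @ v) + \<mu> ((u @ ?X) @ (b, h) # (h, l) # ?Y @ v)
        + \<mu> ((u @ ?X) @ (h, l) # (l, b) # ?Y @ v) = 0"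
      by (rule FK_triangle[OF assms(1) uX Yv]) (use ws hl in auto)
    have 3: "\<mu> ((u @ ?X @ [(b, h)]) @ (h, l) # ?Y @ v) = - \<mu> ((u @ ?X @ [(b, h)]) @ (l, h) # ?Y @ v)"
      by (rule FK_flip[OF assms(1) _ Yv]) (use uX in_vars in auto)
    have 4: "\<mu> ((u @ ?X) @ (h, l) # (l, b) # ?Y @ v) = - \<mu> ((u @ ?X) @ (l, h) # (l, b) # ?Y @ v)"
      by (rule FK_flip[OF assms(1) uX]) (use Yv in_vars in auto)
    have 5: "\<mu> (u @ ?X @ (b, h) # (l, h) # ?Y @ v) = \<mu> (u @ (b, h) # ?X @ (l, h) # ?Y @ v)"
      by (rule FK_move[OF assms(1) Suc.prems(1) _ X])
        (use Yv in_vars hX bXY in \<open>auto dest!: path_vertices\<close>)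
    have 6: "\<mu> ((u @ ?X @ [(l, h)]) @ ?Y @ (l, b) # v) = \<mu> ((u @ ?X @ [(l, h)]) @ (l, b) # ?Y @ v)"
      by (rule FK_move[OF assms(1) _ Suc.prems(2) Y])
        (use uX in_vars lY bXY in \<open>auto dest!: path_vertices\<close>)
    show ?thesis using 1 2 3 4 5 6 by (simp add: p)
  qed
  \<comment> \<open>The first and the last rotation supply the missing summands with index 0:
    together with the inner rotations they complete two copies of the relation for
    \<open>ws\<close>, one with \<open>(b, h)\<close> in front and one with \<open>(l, b)\<close>
    behind.\<close>
  have first: "?S 0 = ?T u ((l, b) # v) 0"
    using path_append[of ws "[b]"] ws by (simp add: vs l_def)
  have last: "?S (Suc (Suc m)) = ?T (u @ [(b, h)]) v 0"
    using path_append[of "[b]" ws] ws len by (simp add: vs h_def)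
  have "(\<Sum>i<Suc (Suc (Suc m)). ?S i) = ?S 0 + (\<Sum>i\<in>{1..Suc m}. ?S i) + ?S (Suc (Suc m))"
    by (rule sum_lessThan_shift_last)
  also have "(\<Sum>i\<in>{1..Suc m}. ?S i) = (\<Sum>i\<in>{1..Suc m}. ?T (u @ [(b, h)]) v i + ?T u ((l, b) # v) i)"
    by (intro sum.cong refl mid)
  also have "\<dots> = (\<Sum>i\<in>{1..Suc m}. ?T (u @ [(b, h)]) v i) + (\<Sum>i\<in>{1..Suc m}. ?T u ((l, b) # v) i)"
    by (rule sum.distrib)
  finally show ?case
    using IH[of "u @ [(b, h)]" v] IH[of u "(l, b) # v"] Suc.prems in_vars first last by simp
qed

section \<open>Circulations and cycles\<close>

definition cyc :: "nat list \<Rightarrow> edge list" where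
  "cyc vs = zip vs (rotate1 vs)"

text \<open>These vectors play two roles: their linear dependences are the circulations behind the
  Orlik--Terao relations, and as linear forms \<open>x_i - x_j\<close> they are the denominators of
  the residues.\<close>

definition evec :: "edge \<Rightarrow> vec" where
  "evec e = (\<lambda>x. (if x = fst e then 1 else 0) - (if x = snd e then 1 else 0))"

lemma evec_swap: "evec (prod.swap e) = (\<lambda>x. - evec e x)"
  by (auto simp: evec_def)

lemma sym_swap: "sym E \<Longrightarrow> prod.swap e \<in> E \<longleftrightarrow> e \<in> E"
  by (cases e) (auto dest: symD)

lemma zip_snoc_path: "zip (a # ws) (ws @ [z]) = path (a # ws) @ [(last (a # ws), z)]"
  by (induction ws arbitrary: a) auto

lemma cyc_path: "vs \<noteq> [] \<Longrightarrow> cyc vs = path vs @ [(last vs, hd vs)]"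
  by (cases vs) (use zip_snoc_path in \<open>auto simp: cyc_def\<close>)

lemma length_cyc [simp]: "length (cyc vs) = length vs"
  by (simp add: cyc_def)

lemma nth_cyc: "i < length vs \<Longrightarrow> cyc vs ! i = (vs ! i, vs ! (Suc i mod length vs))"
  by (simp add: cyc_def nth_rotate1)

lemma distinct_cyc: "distinct vs \<Longrightarrow> distinct (cyc vs)"
  by (simp add: cyc_def distinct_zipI1)

lemma card_cyc: "distinct vs \<Longrightarrow> card (set (cyc vs)) = length vs"
  using distinct_card[OF distinct_cyc] by simp

lemma mset_cyc_rotate: "mset (cyc (drop i vs @ take i vs)) = mset (cyc vs)"
proof (cases "drop i vs = [] \<or> take i vs = []")
  case True
  then show ?thesis by (auto simp: not_le)
next
  case False
  then have "drop i vs \<noteq> []" "take i vs \<noteq> []" by auto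
  moreover from this have "vs \<noteq> []" by auto
  ultimately have "mset (cyc (drop i vs @ take i vs)) = mset (cyc (take i vs @ drop i vs))"
    by (simp add: cyc_path path_append del: append_take_drop_id)
  then show ?thesis by simp
qed

lemma sum_cyc:
  assumes "distinct vs"
  shows "(\<Sum>e\<in>set (cyc vs). evec e x) = 0"
proof -
  have fst: "map fst (cyc vs) = vs" and snd: "map snd (cyc vs) = rotate1 vs"
    by (simp_all add: cyc_def)
  let ?g = "\<lambda>y. if x = y then 1 else (0::rat)"
  have "(\<Sum>e\<in>set (cyc vs). evec e x) = (\<Sum>e\<leftarrow>cyc vs. ?g (fst e) - ?g (snd e))"
    using distinct_cyc[OF assms] by (simp add: sum.distinct_set_conv_list evec_def)
  also have "\<dots> = sum_list (map ?g (map fst (cyc vs))) - sum_list (map ?g (map snd (cyc vs)))"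
    by (simp add: sum_list_subtractf o_def)
  also have "sum_list (map ?g (map snd (cyc vs))) = sum_list (map ?g (map fst (cyc vs)))"
    unfolding fst snd by (cases vs) auto
  finally show ?thesis by simp
qed

text \<open>If an edge and its reverse both occur, their positions are cyclic successors of each
  other, which is impossible from length 3 on.\<close>

lemma cyc_antisym:
  assumes "distinct vs" "length vs \<ge> 3" "e \<in> set (cyc vs)"
  shows "prod.swap e \<notin> set (cyc vs)"
proof
  let ?k = "length vs"
  assume "prod.swap e \<in> set (cyc vs)"
  then obtain i j where ij: "i < ?k" "j < ?k" "cyc vs ! i = e" "cyc vs ! j = prod.swap e"
    using assms(3) by (metis in_set_conv_nth length_cyc)
  then have "vs ! i = vs ! (Suc j mod ?k)" "vs ! j = vs ! (Suc i mod ?k)"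
    by (auto simp: nth_cyc)
  moreover have "Suc j mod ?k < ?k" "Suc i mod ?k < ?k" using assms(2) by (auto intro!: mod_less_divisor)
  ultimately have "i = Suc j mod ?k" "j = Suc i mod ?k"
    using assms(1) ij(1,2) by (auto simp: nth_eq_iff_index_eq)
  moreover have "Suc x mod ?k = (if Suc x = ?k then 0 else Suc x)" if "x < ?k" for x
    using that by (auto simp: mod_Suc)
  ultimately have "i = (if Suc j = ?k then 0 else Suc j)" "j = (if Suc i = ?k then 0 else Suc i)"
    using ij(1,2) by metis+
  then have "Suc j = ?k \<and> i = 0 \<or> i = Suc j" "Suc i = ?k \<and> j = 0 \<or> j = Suc i"
    by metis+
  then show False using assms(2) by (elim disjE conjE) linarith+
qed

text \<open>The path along a rotation is the cycle without its closing edge, and the closing edges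
  of all rotations run through the cycle once. For a functional that ignores the order of letters,
  the sum over rotations thus becomes the sum over deleted edges, the dependence relation with all
  coefficients 1.\<close>

lemma FK_cycle_mset:
  assumes "FK_functional n \<mu>" "set u \<subseteq> FK_vars n"
    and "distinct vs" "set vs \<subseteq> {1..n}" "length vs \<ge> 3"
    and \<mu>: "\<And>w. set w \<subseteq> set u \<union> set (cyc vs) \<Longrightarrow> \<mu> w = \<nu> (mset w)"
  shows "(\<Sum>e\<in>set (cyc vs). \<nu> (mset u + mset_set (set (cyc vs) - {e}))) = 0"
proof -
  let ?F = "set (cyc vs)" and ?k = "length vs"
  let ?r = "\<lambda>i. drop i vs @ take i vs"
  let ?e = "\<lambda>i. (last (?r i), hd (?r i))"
  have ne: "?r i \<noteq> []" for i using assms(5) by (auto simp: not_le)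
  have r: "cyc (?r i) = path (?r i) @ [?e i]" for i by (rule cyc_path[OF ne])
  have hd: "hd (?r i) = vs ! i" if "i < ?k" for i using that by (simp add: hd_drop_conv_nth)
  have inF: "?e i \<in> ?F" for i
  proof -
    have "?e i \<in> set (cyc (?r i))" unfolding r by simp
    then show ?thesis using mset_cyc_rotate[of i vs] by (metis set_mset_mset)
  qed
  have inj: "inj_on ?e {..<?k}"
    using hd assms(3) by (auto intro!: inj_onI simp: nth_eq_iff_index_eq)
  moreover have "?e ` {..<?k} = ?F"
  proof (rule card_subset_eq)
    show "card (?e ` {..<?k}) = card ?F" using card_image[OF inj] card_cyc[OF assms(3)] by simp
    show "?e ` {..<?k} \<subseteq> ?F" using inF by blast
  qed simp
  ultimately have bij: "bij_betw ?e {..<?k} ?F" by (simp add: bij_betw_def)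
  have mset: "mset (path (?r i)) = mset_set (?F - {?e i})" for i
  proof -
    have "mset (path (?r i)) = mset (cyc vs) - {#?e i#}"
      unfolding mset_cyc_rotate[of i vs, symmetric] r by simp
    also have "mset (cyc vs) = mset_set ?F" using distinct_cyc[OF assms(3)] by (simp add: mset_set_set)
    finally show ?thesis using inF by (simp add: mset_set_Diff)
  qed
  define m where "m = ?k - 2"
  have m: "?k = Suc (Suc m)" using assms(5) unfolding m_def by linarith
  have "(\<Sum>i<?k. \<mu> (u @ path (?r i) @ [])) = 0"
    unfolding m by (rule FK_cycle[OF assms(1,2) _ assms(3,4) m]) simp
  then have "0 = (\<Sum>i<?k. \<mu> (u @ path (?r i) @ []))" ..
  also have "\<dots> = (\<Sum>i<?k. \<nu> (mset u + mset_set (?F - {?e i})))"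
  proof (intro sum.cong refl)
    fix i
    have "set (path (?r i)) \<subseteq> ?F" using mset[of i] by (metis Diff_subset finite_Diff finite_set finite_set_mset_mset_set set_mset_mset)
    then show "\<mu> (u @ path (?r i) @ []) = \<nu> (mset u + mset_set (?F - {?e i}))"
      by (subst \<mu>) (auto simp: mset)
  qed
  also have "\<dots> = (\<Sum>e\<in>?F. \<nu> (mset u + mset_set (?F - {e})))"
    by (rule sum.reindex_bij_betw[OF bij])
  finally show ?thesis by simp
qed

section \<open>Functionals on monomials in commuting edge variables\<close>

definition skew :: "edge set \<Rightarrow> (edge multiset \<Rightarrow> rat) \<Rightarrow> bool" where
  "skew E \<nu> \<longleftrightarrow>
     (\<forall>m e. set_mset m \<subseteq> E \<longrightarrow> e \<in> E \<longrightarrow> \<nu> (add_mset (prod.swap e) m) = - \<nu> (add_mset e m)) \<and>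
     (\<forall>m e. set_mset m \<subseteq> E \<longrightarrow> e \<in> E \<longrightarrow> \<nu> (add_mset e (add_mset e m)) = 0)"

text \<open>What the Fomin--Kirillov relations yield directly: dependences given by single cycles,
  traversed in their own orientation.\<close>

definition cyclic_functional :: "edge set \<Rightarrow> (edge multiset \<Rightarrow> rat) \<Rightarrow> bool" where
  "cyclic_functional E \<nu> \<longleftrightarrow> skew E \<nu> \<and>
     (\<forall>m vs. set_mset m \<subseteq> E \<longrightarrow> distinct vs \<longrightarrow> length vs \<ge> 3 \<longrightarrow> set (cyc vs) \<subseteq> E \<longrightarrow>
        (\<Sum>e\<in>set (cyc vs). \<nu> (m + mset_set (set (cyc vs) - {e}))) = 0)"

text \<open>Vanishing on monomials that contain a cycle is a consequence for irreflexive
  \<open>E\<close>, by \<open>OT_functional_has_cycle\<close>. The condition on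
  \<open>prod.swap\<close> says that \<open>D\<close> picks at most one orientation of each
  edge.\<close>

definition OT_functional :: "edge set \<Rightarrow> (edge multiset \<Rightarrow> rat) \<Rightarrow> bool" where
  "OT_functional E \<nu> \<longleftrightarrow> skew E \<nu> \<and>
     (\<forall>m D c. set_mset m \<subseteq> E \<longrightarrow> finite D \<longrightarrow> D \<subseteq> E \<longrightarrow> (\<forall>e\<in>D. prod.swap e \<notin> D) \<longrightarrow>
        (\<forall>x. (\<Sum>e\<in>D. c e * evec e x) = 0) \<longrightarrow>
        (\<Sum>e\<in>D. c e * \<nu> (m + mset_set (D - {e}))) = 0)"

lemma skew_swap: "skew E \<nu> \<Longrightarrow> set_mset m \<subseteq> E \<Longrightarrow> e \<in> E \<Longrightarrow> \<nu> (add_mset (prod.swap e) m) = - \<nu> (add_mset e m)"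
  unfolding skew_def by blast

lemma skew_repeat: "skew E \<nu> \<Longrightarrow> set_mset m \<subseteq> E \<Longrightarrow> count m e \<ge> 2 \<Longrightarrow> \<nu> m = 0"
proof -
  assume *: "skew E \<nu>" "set_mset m \<subseteq> E" "count m e \<ge> 2"
  have "{#e, e#} \<subseteq># m"
  proof (rule mset_subset_eqI)
    show "count {#e, e#} a \<le> count m a" for a using *(3) by (cases "a = e") auto
  qed
  then obtain m' where m': "m = add_mset e (add_mset e m')"
    by (metis add_mset_add_single mset_subset_eq_exists_conv union_mset_add_mset_left add_mset_commute add_0)
  with * show ?thesis unfolding skew_def by (cases e) auto
qed

lemma skew_orient:
  assumes "skew E \<nu>" "sym E" "\<And>e. f e = e \<or> f e = prod.swap e"
    and "set_mset m \<subseteq> E" "set_mset M \<subseteq> E"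
  shows "\<nu> (m + image_mset f M) = (\<Prod>e\<in>#M. if f e = e then 1 else -1) * \<nu> (m + M)"
  using assms(4,5)
proof (induction M arbitrary: m)
  case (add e M)
  have fe: "f e \<in> E" using assms(2) assms(3)[of e] add.prems by (cases e) (auto dest: symD)
  have "\<nu> (m + image_mset f (add_mset e M)) = \<nu> (add_mset (f e) m + image_mset f M)" by simp
  also have "\<dots> = (\<Prod>e\<in>#M. if f e = e then 1 else -1) * \<nu> (add_mset (f e) m + M)"
    using add.prems fe by (intro add.IH) auto
  also have "\<nu> (add_mset (f e) m + M) = (if f e = e then 1 else -1) * \<nu> (add_mset e m + M)"
    using assms(3)[of e] skew_swap[OF assms(1), of "m + M" e] add.prems by auto
  finally show ?case by simp
qed simp

lemma path_prefix: "set (path vs) \<subseteq> set (path (vs @ ws))"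
  by (cases "vs = [] \<or> ws = []") (auto simp: path_append)

text \<open>No vertex has degree one, so the first vertex of a longest path has a second neighbour on that path.\<close>
lemma circulation_has_cycle:
  assumes "finite D" "D \<noteq> {}" "\<And>e. e \<in> D \<Longrightarrow> prod.swap e \<notin> D" "\<And>e. e \<in> D \<Longrightarrow> c e \<noteq> 0"
    and bal: "\<And>x. (\<Sum>e\<in>D. c e * evec e x) = 0"
  obtains vs where "distinct vs" "length vs \<ge> 3" "\<And>e. e \<in> set (cyc vs) \<Longrightarrow> e \<in> D \<or> prod.swap e \<in> D"
proof -
  define R where "R a b \<longleftrightarrow> (a, b) \<in> D \<or> (b, a) \<in> D" for a b
  have irr: "\<not> R a a" for a using assms(3)[of "(a, a)"] by (auto simp: R_def)
  \<comment> \<open>Were \<open>b\<close> the only neighbour of \<open>a\<close>, a single edge of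
    \<open>D\<close> would contribute to the balance at \<open>a\<close>, with a nonzero
    coefficient.\<close>
  have deg: "\<exists>b'. b' \<noteq> b \<and> R a b'" if ab: "R a b" for a b
  proof (rule ccontr)
    assume no: "\<not> (\<exists>b'. b' \<noteq> b \<and> R a b')"
    have "a \<noteq> b" using ab irr by auto
    from ab obtain e where e: "e \<in> D" "e = (a, b) \<or> e = (b, a)" by (auto simp: R_def)
    have "c e' * evec e' a = 0" if "e' \<in> D - {e}" for e'
    proof (cases "fst e' = a \<or> snd e' = a")
      case True
      with that no have "e' = (a, b) \<or> e' = (b, a)"
        by (cases e') (auto simp: R_def)
      with that e assms(3) show ?thesis by auto
    qed (auto simp: evec_def)
    then have "(\<Sum>e\<in>D - {e}. c e * evec e a) = 0" by (rule sum.neutral[OF ballI])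
    then have "(\<Sum>e\<in>D. c e * evec e a) = c e * evec e a"
      using sum.remove[OF assms(1) e(1), of "\<lambda>e. c e * evec e a"] by simp
    with bal[of a] assms(4)[OF e(1)] e(2) \<open>a \<noteq> b\<close> show False by (auto simp: evec_def)
  qed
  define V where "V = fst ` D \<union> snd ` D"
  have finV: "finite V" using assms(1) by (simp add: V_def)
  define P where "P vs \<longleftrightarrow> distinct vs \<and> length vs \<ge> 2 \<and> set vs \<subseteq> V \<and> (\<forall>(a, b)\<in>set (path vs). R a b)" for vs
  from assms(2) obtain a0 b0 where ab0: "(a0, b0) \<in> D" by auto
  then have "a0 \<noteq> b0" using assms(3)[of "(a0, b0)"] by auto
  with ab0 have "P [a0, b0]" by (force simp: P_def R_def V_def)
  moreover have "\<forall>vs. P vs \<longrightarrow> length vs < Suc (card V)"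
    using finV by (auto simp: P_def distinct_card[symmetric] less_Suc_eq_le intro: card_mono)
  ultimately obtain vs where vs: "P vs" and max: "\<And>ws. P ws \<Longrightarrow> length ws \<le> length vs"
    using ex_has_greatest_nat[of P "[a0, b0]" length "Suc (card V)"] by blast
  from vs obtain a b rest where abr: "vs = a # b # rest"
    unfolding P_def by (metis One_nat_def Suc_1 Suc_le_length_iff)
  have "R a b" using vs by (auto simp: P_def abr)
  then obtain b' where b': "b' \<noteq> b" "R a b'" using deg by blast
  have "b' \<in> set vs"
  proof (rule ccontr)
    assume "b' \<notin> set vs"
    moreover have "b' \<in> V" using b'(2) by (force simp: R_def V_def)
    moreover have "R b' a" using b'(2) by (auto simp: R_def)
    ultimately have "P (b' # vs)" using vs by (auto simp: P_def abr)
    from max[OF this] show False by simp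
  qed
  moreover have "b' \<noteq> a" using b'(2) irr by auto
  \<comment> \<open>Neither \<open>a\<close> nor \<open>b\<close>, the second neighbour comes after
    \<open>b\<close> on the path, so closing the path at \<open>b'\<close> gives at least three
    vertices.\<close>
  ultimately have "b' \<in> set rest" using b'(1) by (auto simp: abr)
  then obtain xs ys where rest: "rest = xs @ b' # ys" by (meson split_list)
  let ?vs = "a # b # xs @ [b']"
  have vs': "vs = ?vs @ ys" by (simp add: abr rest)
  have "R x y" if "(x, y) \<in> set (cyc ?vs)" for x y
  proof -
    have "(x, y) \<in> set (path ?vs) \<or> (x, y) = (b', a)"
      using that by (subst (asm) cyc_path) auto
    moreover have "R b' a" using b'(2) by (auto simp: R_def)
    ultimately show ?thesis
      using vs path_prefix[of ?vs ys] unfolding P_def vs' by blast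
  qed
  then have "e \<in> D \<or> prod.swap e \<in> D" if "e \<in> set (cyc ?vs)" for e
    using that by (cases e) (auto simp: R_def)
  moreover have "distinct ?vs" using vs unfolding P_def vs' by auto
  ultimately show thesis by (intro that[of ?vs]) auto
qed

text \<open>The unit circulation around the cycle, in the coordinates of an edge set whose
  orientations need not follow the cycle.\<close>

definition cycle_sign :: "nat list \<Rightarrow> edge \<Rightarrow> rat" where
  "cycle_sign vs e = (if e \<in> set (cyc vs) then 1 else if prod.swap e \<in> set (cyc vs) then -1 else 0)"

context
  fixes D :: "edge set" and vs :: "nat list"
  assumes D: "finite D" "\<And>e. e \<in> D \<Longrightarrow> prod.swap e \<notin> D"
    and vs: "distinct vs" "length vs \<ge> 3" "\<And>e. e \<in> set (cyc vs) \<Longrightarrow> e \<in> D \<or> prod.swap e \<in> D"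
begin

text \<open>Turns the edges that the cycle traverses backwards, so that up to sign the monomial of
  the cycle is a factor of that of \<open>D\<close>.\<close>

definition reorient :: "edge \<Rightarrow> edge" where
  "reorient e = (if prod.swap e \<in> set (cyc vs) then prod.swap e else e)"

lemma reorient_cases: "reorient e = e \<or> reorient e = prod.swap e"
  by (simp add: reorient_def)

lemma swap_neq: "e \<in> D \<Longrightarrow> prod.swap e \<noteq> e"
  using D(2) by metis

lemma reorient_bij: "bij_betw reorient {e \<in> D. cycle_sign vs e \<noteq> 0} (set (cyc vs))"
  unfolding bij_betw_def
proof
  show "inj_on reorient {e \<in> D. cycle_sign vs e \<noteq> 0}"
    using D(2) by (auto intro!: inj_onI simp: reorient_def split: if_splits)
  show "reorient ` {e \<in> D. cycle_sign vs e \<noteq> 0} = set (cyc vs)"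
  proof (intro equalityI subsetI)
    fix e assume "e \<in> reorient ` {e \<in> D. cycle_sign vs e \<noteq> 0}"
    then show "e \<in> set (cyc vs)"
      by (auto simp: reorient_def cycle_sign_def split: if_splits)
  next
    fix e assume e: "e \<in> set (cyc vs)"
    have ns: "prod.swap e \<notin> set (cyc vs)" using cyc_antisym[OF vs(1,2) e] .
    from vs(3)[OF e] show "e \<in> reorient ` {e \<in> D. cycle_sign vs e \<noteq> 0}"
    proof
      assume "e \<in> D"
      then show ?thesis using e ns by (intro image_eqI[of _ _ e]) (auto simp: reorient_def cycle_sign_def)
    next
      assume "prod.swap e \<in> D"
      then show ?thesis using e ns by (intro image_eqI[of _ _ "prod.swap e"]) (auto simp: reorient_def cycle_sign_def)
    qed
  qed
qed

lemma cycle_sign_reorient: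
  assumes "e \<in> D" "cycle_sign vs e \<noteq> 0"
  shows "cycle_sign vs e = (if reorient e = e then 1 else -1)"
proof (cases "e \<in> set (cyc vs)")
  case True
  with cyc_antisym[OF vs(1,2) True] show ?thesis by (simp add: cycle_sign_def reorient_def)
next
  case False
  with assms(2) have "prod.swap e \<in> set (cyc vs)" by (auto simp: cycle_sign_def split: if_splits)
  with False swap_neq[OF assms(1)] show ?thesis by (simp add: cycle_sign_def reorient_def)
qed

lemma cycle_sign_balanced: "(\<Sum>e\<in>D. cycle_sign vs e * evec e x) = 0"
proof -
  have "(\<Sum>e\<in>D. cycle_sign vs e * evec e x) = (\<Sum>e\<in>{e \<in> D. cycle_sign vs e \<noteq> 0}. cycle_sign vs e * evec e x)"
    using D(1) by (intro sum.mono_neutral_right) auto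
  also have "\<dots> = (\<Sum>e\<in>{e \<in> D. cycle_sign vs e \<noteq> 0}. evec (reorient e) x)"
  proof (intro sum.cong refl)
    fix e assume "e \<in> {e \<in> D. cycle_sign vs e \<noteq> 0}"
    then have "cycle_sign vs e = (if reorient e = e then 1 else -1)"
      using cycle_sign_reorient by blast
    then show "cycle_sign vs e * evec e x = evec (reorient e) x"
      using reorient_cases[of e] evec_swap[of e] by (cases "reorient e = e") simp_all
  qed
  also have "\<dots> = (\<Sum>e\<in>set (cyc vs). evec e x)"
    by (rule sum.reindex_bij_betw[OF reorient_bij])
  finally show ?thesis using sum_cyc[OF vs(1)] by simp
qed

lemma cycle_sign_nonzero: "\<exists>e\<in>D. cycle_sign vs e \<noteq> 0"
proof -
  have "set (cyc vs) \<noteq> {}" using vs(2) card_cyc[OF vs(1)] by auto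
  then have "reorient ` {e \<in> D. cycle_sign vs e \<noteq> 0} \<noteq> {}"
    using bij_betw_imp_surj_on[OF reorient_bij] by simp
  then show ?thesis by auto
qed

text \<open>Reorienting \<open>D - {e}\<close> along the cycle costs the signs of all its edges; the
  coefficient of \<open>e\<close> supplies the remaining sign. So every term has the same factor
  \<open>P\<close>, and the sum is \<open>P\<close> times the cycle relation in the context of
  \<open>m\<close> and the edges of \<open>D\<close> off the cycle.\<close>

lemma cyclic_functional_cycle_sign:
  assumes \<nu>: "cyclic_functional E \<nu>" and E: "sym E" "D \<subseteq> E" and m: "set_mset m \<subseteq> E"
  shows "(\<Sum>e\<in>D. cycle_sign vs e * \<nu> (m + mset_set (D - {e}))) = 0"
proof -
  have sk: "skew E \<nu>" using \<nu> by (simp add: cyclic_functional_def)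
  let ?D1 = "{e \<in> D. cycle_sign vs e \<noteq> 0}" and ?D0 = "{e \<in> D. cycle_sign vs e = 0}"
  let ?F = "set (cyc vs)"
  have FE: "?F \<subseteq> E"
  proof
    fix e assume "e \<in> ?F"
    then show "e \<in> E" using vs(3)[of e] E sym_swap[of E e] by blast
  qed
  define sg where "sg e = (if reorient e = e then 1 else -1 :: rat)" for e
  have sg2: "sg e * sg e = 1" for e by (simp add: sg_def)
  define P where "P = prod sg D"
  have summand: "cycle_sign vs e * \<nu> (m + mset_set (D - {e})) = P * \<nu> ((m + mset_set ?D0) + mset_set (?F - {reorient e}))"
    if e: "e \<in> ?D1" for e
  proof -
    have fin: "finite (D - {e})" using D(1) by simp
    have "\<nu> (m + image_mset reorient (mset_set (D - {e}))) = (\<Prod>e\<in>#mset_set (D - {e}). sg e) * \<nu> (m + mset_set (D - {e}))"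
      unfolding sg_def using skew_orient[OF sk E(1) reorient_cases m, of "mset_set (D - {e})"] E(2) D(1) by auto
    also have "(\<Prod>e\<in>#mset_set (D - {e}). sg e) = prod sg (D - {e})"
      by (simp add: prod_unfold_prod_mset)
    finally have 1: "\<nu> (m + image_mset reorient (mset_set (D - {e}))) = prod sg (D - {e}) * \<nu> (m + mset_set (D - {e}))" .
    have "prod sg (D - {e}) * prod sg (D - {e}) = 1"
      unfolding prod.distrib[symmetric] sg2 by simp
    moreover have "P = sg e * prod sg (D - {e})"
      unfolding P_def using e D(1) by (simp add: prod.remove)
    moreover have "sg e = cycle_sign vs e" using e cycle_sign_reorient by (simp add: sg_def)
    ultimately have 2: "P * \<nu> (m + image_mset reorient (mset_set (D - {e}))) = cycle_sign vs e * \<nu> (m + mset_set (D - {e}))"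
      unfolding 1 by simp
    have "D - {e} = ?D0 \<union> (?D1 - {e})" using e by auto
    then have "mset_set (D - {e}) = mset_set ?D0 + mset_set (?D1 - {e})"
      using D(1) by (simp add: mset_set_Union disjoint_iff)
    moreover have "image_mset reorient (mset_set ?D0) = mset_set ?D0"
      using D(1) by (intro image_mset_cong[where g = id, simplified]) (auto simp: reorient_def cycle_sign_def split: if_splits)
    moreover have "image_mset reorient (mset_set (?D1 - {e})) = mset_set (?F - {reorient e})"
    proof -
      have inj: "inj_on reorient ?D1" and im: "reorient ` ?D1 = ?F" using reorient_bij by (auto simp: bij_betw_def)
      have "reorient ` (?D1 - {e}) = ?F - {reorient e}"
        using inj_on_image_set_diff[OF inj, of ?D1 "{e}"] e im by auto
      then show ?thesis
        using image_mset_mset_set[OF inj_on_subset[OF inj], of "?D1 - {e}"] by auto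
    qed
    ultimately show ?thesis using 2 by (simp add: add.assoc)
  qed
  have "(\<Sum>e\<in>D. cycle_sign vs e * \<nu> (m + mset_set (D - {e})))
      = (\<Sum>e\<in>?D1. cycle_sign vs e * \<nu> (m + mset_set (D - {e})))"
    using D(1) by (intro sum.mono_neutral_right) auto
  also have "\<dots> = (\<Sum>e\<in>?D1. P * \<nu> ((m + mset_set ?D0) + mset_set (?F - {reorient e})))"
    by (intro sum.cong refl summand)
  also have "\<dots> = (\<Sum>e\<in>?F. P * \<nu> ((m + mset_set ?D0) + mset_set (?F - {e})))"
    by (rule sum.reindex_bij_betw[OF reorient_bij])
  also have "\<dots> = P * (\<Sum>e\<in>?F. \<nu> ((m + mset_set ?D0) + mset_set (?F - {e})))"
    by (rule sum_distrib_left[symmetric])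
  also have "(\<Sum>e\<in>?F. \<nu> ((m + mset_set ?D0) + mset_set (?F - {e}))) = 0"
  proof -
    have "set_mset (m + mset_set ?D0) \<subseteq> E" using m E(2) D(1) by auto
    then show ?thesis using \<nu> vs(1,2) FE unfolding cyclic_functional_def by blast
  qed
  finally show ?thesis by simp
qed

end

lemma cyclic_imp_OT_functional:
  assumes \<nu>: "cyclic_functional E \<nu>" and E: "sym E"
  shows "OT_functional E \<nu>"
proof -
  have core: "(\<Sum>e\<in>D. c e * \<nu> (m + mset_set (D - {e}))) = 0"
    if m: "set_mset m \<subseteq> E" and D: "finite D" "D \<subseteq> E" "\<And>e. e \<in> D \<Longrightarrow> prod.swap e \<notin> D"
      and bal: "\<And>x. (\<Sum>e\<in>D. c e * evec e x) = 0" for m D c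
    using bal
  proof (induction "card {e \<in> D. c e \<noteq> 0}" arbitrary: c rule: less_induct)
    case less
    let ?S = "{e \<in> D. c e \<noteq> 0}"
    show ?case
    proof (cases "?S = {}")
      case True
      then show ?thesis by (auto intro!: sum.neutral)
    next
      case False
      have S: "finite ?S" "\<And>e. e \<in> ?S \<Longrightarrow> prod.swap e \<notin> ?S" using D by auto
      have "(\<Sum>e\<in>?S. c e * evec e x) = 0" for x
        using less.prems[of x] D(1) by (subst sum.mono_neutral_left[of D]) auto
      then obtain vs where vs: "distinct vs" "length vs \<ge> 3"
          "\<And>e. e \<in> set (cyc vs) \<Longrightarrow> e \<in> ?S \<or> prod.swap e \<in> ?S"
        using circulation_has_cycle[OF S(1) False S(2), of c] by blast
      let ?x = "cycle_sign vs"
      obtain e0 where e0: "e0 \<in> ?S" "?x e0 \<noteq> 0" using cycle_sign_nonzero[OF S vs] by auto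
      have xS: "c e \<noteq> 0" if "e \<in> D" "?x e \<noteq> 0" for e
        using vs(3)[of e] vs(3)[of "prod.swap e"] that D(3)[OF that(1)]
        by (auto simp: cycle_sign_def split: if_splits)
      have vsD: "\<And>e. e \<in> set (cyc vs) \<Longrightarrow> e \<in> D \<or> prod.swap e \<in> D" using vs(3) by blast
      \<comment> \<open>The multiple is chosen to cancel the coefficient at \<open>e0\<close>. Since
        the cycle lies in the support of \<open>c\<close>, nothing is added to the support.\<close>
      define c' where "c' e = c e - c e0 / ?x e0 * ?x e" for e
      have "{e \<in> D. c' e \<noteq> 0} \<subset> ?S"
      proof
        show "{e \<in> D. c' e \<noteq> 0} \<subseteq> ?S" using xS by (auto simp: c'_def)
        have "c' e0 = 0" using e0 by (simp add: c'_def)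
        then show "{e \<in> D. c' e \<noteq> 0} \<noteq> ?S" using e0 by blast
      qed
      then have "card {e \<in> D. c' e \<noteq> 0} < card ?S" using S(1) by (rule psubset_card_mono[rotated])
      moreover have c': "(\<Sum>e\<in>D. c' e * g e) = (\<Sum>e\<in>D. c e * g e) - c e0 / ?x e0 * (\<Sum>e\<in>D. ?x e * g e)" for g
        unfolding c'_def by (simp add: left_diff_distrib sum_subtractf mult.assoc sum_distrib_left)
      moreover have "(\<Sum>e\<in>D. c' e * evec e x) = 0" for x
        using less.prems[of x] cycle_sign_balanced[OF D(1,3) vs(1,2) vsD, of x]
        unfolding c' by simp
      ultimately have "(\<Sum>e\<in>D. c' e * \<nu> (m + mset_set (D - {e}))) = 0"
        by (intro less.hyps) auto
      then show ?thesis
        unfolding c' using cyclic_functional_cycle_sign[OF D(1,3) vs(1,2) vsD \<nu> E D(2) m] by simp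
    qed
  qed
  show ?thesis
    unfolding OT_functional_def
  proof (intro conjI allI impI)
    show "skew E \<nu>" using \<nu> by (simp add: cyclic_functional_def)
  qed (rule core; simp)
qed

section \<open>Functionals on the Orlik--Terao algebra\<close>

lemma c_fin_mono: "c_fin (c_mono m)"
  by (auto simp: c_fin_def c_mono_def)

lemma c_over_mono: "set_mset m \<subseteq> V \<Longrightarrow> c_over V (c_mono m)"
  by (auto simp: c_over_def c_fin_def c_mono_def)

lemma c_fin_add: "c_fin p \<Longrightarrow> c_fin q \<Longrightarrow> c_fin (c_add p q)"
  unfolding c_fin_def c_add_def
  by (rule finite_subset[of _ "{w. p w \<noteq> 0} \<union> {w. q w \<noteq> 0}"]) auto

lemma pr_c_add: "c_fin p \<Longrightarrow> c_fin q \<Longrightarrow> pr (c_add p q) \<mu> = pr p \<mu> + pr q \<mu>"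
  unfolding c_add_def c_fin_def by (rule pr_add)

lemma pr_c_mono: "pr (c_mono m) \<nu> = \<nu> m"
  unfolding c_mono_def by (rule pr_indicator)

lemma c_over_fin: "c_over V p \<Longrightarrow> c_fin p"
  by (simp add: c_over_def)

lemma c_ideal_fin:
  assumes "p \<in> c_ideal V S" "\<And>s. s \<in> S \<Longrightarrow> c_fin s"
  shows "c_fin p"
  using assms(1)
  by induction (auto simp: c_zero_def c_fin_def[of "\<lambda>_. 0"] assms(2) c_over_fin intro!: c_fin_add c_fin_mul)

lemma c_ideal_kill:
  assumes p: "p \<in> c_ideal V S" and S: "\<And>s. s \<in> S \<Longrightarrow> c_fin s"
    and kill: "\<And>s m. s \<in> S \<Longrightarrow> set_mset m \<subseteq> V \<Longrightarrow> pr s (\<lambda>x. \<nu> (m + x)) = 0"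
    and "set_mset m \<subseteq> V"
  shows "pr p (\<lambda>x. \<nu> (m + x)) = 0"
  using p assms(4)
proof (induction arbitrary: m)
  case zero
  then show ?case by (simp add: pr_def c_zero_def)
next
  case (gen s)
  then show ?case using kill by blast
next
  case (add p q)
  then show ?case using c_ideal_fin[of _ V S] S by (subst pr_c_add) auto
next
  case (mul p a)
  have fin: "c_fin p" "c_fin a"
    using c_ideal_fin[OF mul.hyps(1)] S mul.hyps by (auto intro: c_over_fin)
  have "pr (c_mul a p) (\<lambda>x. \<nu> (m + x)) = pr a (\<lambda>y. pr p (\<lambda>x. \<nu> ((m + y) + x)))"
    using fin by (simp add: pr_c_mul add.assoc)
  also have "\<dots> = 0"
    using mul.hyps mul.prems by (intro pr_eq_0 mul.IH) (auto simp: c_over_def)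
  finally show ?case .
qed

lemma c_ideal_context:
  assumes kill: "\<And>p. p \<in> c_ideal V S \<Longrightarrow> pr p \<nu> = 0"
    and s: "s \<in> S" "c_fin s" and "set_mset m \<subseteq> V"
  shows "pr s (\<lambda>x. \<nu> (m + x)) = 0"
proof -
  have "c_mul (c_mono m) s \<in> c_ideal V S"
    using assms by (intro c_ideal.mul c_ideal.gen c_over_mono)
  from kill[OF this] show ?thesis
    using s by (simp add: pr_c_mul pr_c_mono c_fin_mono)
qed

definition dependence_rel :: "edge list \<Rightarrow> rat list \<Rightarrow> cpoly" where
  "dependence_rel ps cs = (\<lambda>m. \<Sum>p<length ps. cs ! p * (if m = mset (take p ps @ drop (Suc p) ps) then 1 else 0))"

lemma c_fin_dependence_rel: "c_fin (dependence_rel ps cs)"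
  unfolding c_fin_def
proof (rule finite_subset)
  show "{m. dependence_rel ps cs m \<noteq> 0} \<subseteq> (\<lambda>p. mset (take p ps @ drop (Suc p) ps)) ` {..<length ps}"
    unfolding dependence_rel_def by (auto elim!: sum.not_neutral_contains_not_neutral split: if_splits)
qed simp

lemma pr_dependence_rel:
  assumes "distinct ps"
  shows "pr (dependence_rel ps cs) \<nu> = (\<Sum>p<length ps. cs ! p * \<nu> (mset_set (set ps - {ps ! p})))"
proof -
  let ?M = "\<lambda>p. mset (take p ps @ drop (Suc p) ps)"
  let ?A = "?M ` {..<length ps}"
  have "pr (dependence_rel ps cs) \<nu> = (\<Sum>m\<in>?A. dependence_rel ps cs m * \<nu> m)"
    unfolding dependence_rel_def by (rule pr_superset) (auto elim!: sum.not_neutral_contains_not_neutral split: if_splits)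
  also have "\<dots> = (\<Sum>p<length ps. \<Sum>m\<in>?A. cs ! p * (if m = ?M p then 1 else 0) * \<nu> m)"
    unfolding dependence_rel_def sum_distrib_right by (rule sum.swap)
  also have "\<dots> = (\<Sum>p<length ps. cs ! p * \<nu> (?M p))"
  proof (intro sum.cong refl)
    fix p assume p: "p \<in> {..<length ps}"
    have "(\<Sum>m\<in>?A. cs ! p * (if m = ?M p then 1 else 0) * \<nu> m) = (\<Sum>m\<in>?A. if m = ?M p then cs ! p * \<nu> (?M p) else 0)"
      by (intro sum.cong) auto
    also have "\<dots> = cs ! p * \<nu> (?M p)"
      using p by (subst sum.delta) auto
    finally show "(\<Sum>m\<in>?A. cs ! p * (if m = ?M p then 1 else 0) * \<nu> m) = cs ! p * \<nu> (?M p)" .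
  qed
  also have "\<dots> = (\<Sum>p<length ps. cs ! p * \<nu> (mset_set (set ps - {ps ! p})))"
  proof (intro sum.cong refl)
    fix p assume p: "p \<in> {..<length ps}"
    have "mset ps = mset (take p ps @ ps ! p # drop (Suc p) ps)" using p by (simp add: id_take_nth_drop[symmetric])
    then have "mset ps = add_mset (ps ! p) (?M p)" by simp
    moreover have "mset ps = mset_set (set ps)" using assms by (simp add: mset_set_set)
    ultimately have "?M p = mset_set (set ps) - {#ps ! p#}" by (metis add_mset_remove_trivial)
    also have "\<dots> = mset_set (set ps - {ps ! p})" using p by (subst mset_set_Diff) auto
    finally show "cs ! p * \<nu> (?M p) = cs ! p * \<nu> (mset_set (set ps - {ps ! p}))" by simp
  qed
  finally show ?thesis .
qed

lemma irrefl_swap: "irrefl E \<Longrightarrow> e \<in> E \<Longrightarrow> prod.swap e \<noteq> e"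
  by (cases e) (auto simp: irrefl_def)

lemma OT_rels_eq:
  "OT_rels n E =
     {c_add (c_mono {#(i, j)#}) (c_mono {#(j, i)#}) | i j. (i, j) \<in> E}
   \<union> {c_mono m | m. set_mset m \<subseteq> E \<and> (has_repeat m \<or> has_cycle (set_mset m))}
   \<union> {dependence_rel ps cs | ps cs. length cs = length ps \<and> set ps \<subseteq> E \<and>
        distinct (map (\<lambda>(i, j). {i, j}) ps) \<and> (\<forall>v. (\<Sum>p<length ps. cs ! p * evec (ps ! p) v) = 0)}"
  unfolding OT_rels_def dependence_rel_def evec_def ..

lemma OT_rels_fin: "s \<in> OT_rels n E \<Longrightarrow> c_fin s"
  unfolding OT_rels_eq
  by (auto intro!: c_fin_add c_fin_mono c_fin_dependence_rel)

lemma skew_has_repeat: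
  assumes "skew E \<nu>" "irrefl E" "set_mset m \<subseteq> E" "has_repeat m"
  shows "\<nu> m = 0"
proof -
  from assms(4) obtain i j where ij: "count m (i, j) + count m (j, i) \<ge> 2"
    unfolding has_repeat_def by blast
  consider "count m (i, j) \<ge> 2" | "count m (j, i) \<ge> 2" | "count m (i, j) = 1" "count m (j, i) = 1"
    using ij by linarith
  then show ?thesis
  proof cases
    \<comment> \<open>One copy of each orientation: flipping one of them produces a square.
      Irreflexivity matters, since \<open>has_repeat\<close> would count a single loop
      twice.\<close>
    case 3
    then have in_m: "(i, j) \<in># m" "(j, i) \<in># m" by (auto simp: count_greater_zero_iff[symmetric] simp del: count_greater_zero_iff)
    then have ne: "i \<noteq> j" using assms(2,3) by (auto simp: irrefl_def)
    define m' where "m' = m - {#(i, j)#}"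
    have m: "m = add_mset (i, j) m'" using in_m by (simp add: m'_def)
    have c: "count m' (j, i) = 1" using 3 ne by (simp add: m'_def)
    have m'E: "set_mset m' \<subseteq> E" using assms(3) m by auto
    have "\<nu> (add_mset (prod.swap (i, j)) m') = - \<nu> m"
      using skew_swap[OF assms(1) m'E, of "(i, j)"] in_m assms(3) m by auto
    moreover have "\<nu> (add_mset (j, i) m') = 0"
      using skew_repeat[OF assms(1), of "add_mset (j, i) m'" "(j, i)"] c m'E in_m assms(3) by auto
    ultimately show ?thesis by simp
  qed (use skew_repeat[OF assms(1,3)] in auto)
qed

lemma no_repeat_mset_set:
  assumes "\<not> has_repeat m"
  shows "m = mset_set (set_mset m)" "\<And>e. e \<in># m \<Longrightarrow> prod.swap e \<notin># m"
proof -
  have le: "count m (i, j) + count m (j, i) \<le> 1" for i j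
  proof -
    have "\<not> 2 \<le> count m (i, j) + count m (j, i)" using assms unfolding has_repeat_def by blast
    then show ?thesis by linarith
  qed
  show "prod.swap e \<notin># m" if "e \<in># m" for e
  proof
    assume "prod.swap e \<in># m"
    then have "count m e > 0" "count m (prod.swap e) > 0" using that by auto
    then show False using le[of "fst e" "snd e"] by (cases e) (simp del: count_greater_zero_iff)
  qed
  show "m = mset_set (set_mset m)"
  proof (rule multiset_eqI)
    fix e
    have "count m e \<le> 1" using le[of "fst e" "snd e"] by (cases e) auto
    then show "count m e = count (mset_set (set_mset m)) e"
      by (cases "e \<in># m") (auto simp: count_mset_set count_eq_zero_iff le_Suc_eq)
  qed
qed

lemma OT_functional_dependence:
  "OT_functional E \<nu> \<Longrightarrow> set_mset m \<subseteq> E \<Longrightarrow> finite D \<Longrightarrow> D \<subseteq> E \<Longrightarrow> (\<And>e. e \<in> D \<Longrightarrow> prod.swap e \<notin> D) \<Longrightarrow>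
     (\<And>x. (\<Sum>e\<in>D. c e * evec e x) = 0) \<Longrightarrow> (\<Sum>e\<in>D. c e * \<nu> (m + mset_set (D - {e}))) = 0"
  unfolding OT_functional_def by simp

text \<open>Multiplying the dependence relation by \<open>e0\<close> creates a square in every term but one.\<close>
lemma OT_functional_dependent:
  assumes \<nu>: "OT_functional E \<nu>" and D: "finite D" "D \<subseteq> E" "\<And>e. e \<in> D \<Longrightarrow> prod.swap e \<notin> D"
    and bal: "\<And>x. (\<Sum>e\<in>D. c e * evec e x) = 0" and e0: "e0 \<in> D" "c e0 \<noteq> 0"
  shows "\<nu> (mset_set D) = 0"
proof -
  have sk: "skew E \<nu>" using \<nu> by (simp add: OT_functional_def)
  have "0 = (\<Sum>e\<in>D. c e * \<nu> ({#e0#} + mset_set (D - {e})))"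
    using OT_functional_dependence[OF \<nu> _ D bal, of "{#e0#}"] e0 D(2) by auto
  also have "\<dots> = c e0 * \<nu> ({#e0#} + mset_set (D - {e0}))
      + (\<Sum>e\<in>D - {e0}. c e * \<nu> ({#e0#} + mset_set (D - {e})))"
    by (rule sum.remove[OF D(1) e0(1)])
  also have "(\<Sum>e\<in>D - {e0}. c e * \<nu> ({#e0#} + mset_set (D - {e}))) = 0"
  proof (intro sum.neutral ballI)
    fix e assume e: "e \<in> D - {e0}"
    have "\<nu> ({#e0#} + mset_set (D - {e})) = 0"
      by (rule skew_repeat[OF sk, of _ e0]) (use e e0(1) D(1,2) in \<open>auto simp: count_mset_set\<close>)
    then show "c e * \<nu> ({#e0#} + mset_set (D - {e})) = 0" by simp
  qed
  also have "{#e0#} + mset_set (D - {e0}) = mset_set D"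
    using mset_set.remove[OF D(1) e0(1)] by simp
  finally show ?thesis using e0(2) by simp
qed

text \<open>A monomial without repetition is the set of its edges, and the signs of the cycle form a
  dependence on that set with a nonzero coefficient, so \<open>OT_functional_dependent\<close>
  applies.\<close>

lemma OT_functional_has_cycle:
  assumes \<nu>: "OT_functional E \<nu>" and E: "irrefl E" "set_mset m \<subseteq> E" and cyc: "has_cycle (set_mset m)"
  shows "\<nu> m = 0"
proof (cases "has_repeat m")
  case True
  then show ?thesis using skew_has_repeat[of E] assms by (simp add: OT_functional_def)
next
  case False
  note m = no_repeat_mset_set[OF False]
  from cyc obtain vs where vs: "length vs \<ge> 3" "distinct vs" and
    *: "\<And>i. i < length vs \<Longrightarrow> (vs ! i, vs ! ((i + 1) mod length vs)) \<in> set_mset m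
                    \<or> (vs ! ((i + 1) mod length vs), vs ! i) \<in> set_mset m"
    unfolding has_cycle_def by blast
  have vsD: "e \<in> set_mset m \<or> prod.swap e \<in> set_mset m" if e: "e \<in> set (cyc vs)" for e
  proof -
    from e obtain i where "i < length vs" "e = cyc vs ! i" by (metis in_set_conv_nth length_cyc)
    then show ?thesis using *[of i] by (simp add: nth_cyc)
  qed
  obtain e0 where e0: "e0 \<in># m" "cycle_sign vs e0 \<noteq> 0"
    using cycle_sign_nonzero[OF finite_set_mset m(2) vs(2,1) vsD] by blast
  have "\<nu> (mset_set (set_mset m)) = 0"
    using OT_functional_dependent[OF \<nu> finite_set_mset E(2) m(2)
        cycle_sign_balanced[OF finite_set_mset m(2) vs(2,1) vsD] e0] .
  then show ?thesis using m(1) by simp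
qed

text \<open>Together with \<open>OT_functionalI\<close> this characterises the functionals vanishing
  on the Orlik--Terao ideal by conditions on sets of edges.\<close>

lemma OT_functional_kill:
  assumes \<nu>: "OT_functional E \<nu>" and E: "sym E" "irrefl E" and f: "f \<in> OT_ideal n E"
  shows "pr f \<nu> = 0"
proof -
  have sk: "skew E \<nu>" using \<nu> by (simp add: OT_functional_def)
  have "pr s (\<lambda>x. \<nu> (m + x)) = 0" if s: "s \<in> OT_rels n E" and m: "set_mset m \<subseteq> E" for s m
  proof -
    from s consider
      (flip) i j where "s = c_add (c_mono {#(i, j)#}) (c_mono {#(j, i)#})" "(i, j) \<in> E"
    | (mono) x where "s = c_mono x" "set_mset x \<subseteq> E" "has_repeat x \<or> has_cycle (set_mset x)"
    | (dep) ps cs where "s = dependence_rel ps cs" "length cs = length ps" "set ps \<subseteq> E"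
        "distinct (map (\<lambda>(i, j). {i, j}) ps)"
        "\<forall>v. (\<Sum>p<length ps. cs ! p * evec (ps ! p) v) = 0"
      unfolding OT_rels_eq by blast
    then show ?thesis
    proof cases
      case flip
      then show ?thesis
        using skew_swap[OF sk m, of "(i, j)"] by (simp add: pr_c_add pr_c_mono c_fin_mono)
    next
      case mono
      have mx: "set_mset (m + x) \<subseteq> E" using m mono by auto
      have "\<nu> (m + x) = 0"
      proof (cases "has_repeat x")
        case True
        then obtain i j where "count x (i, j) + count x (j, i) \<ge> 2" unfolding has_repeat_def by blast
        then have "count (m + x) (i, j) + count (m + x) (j, i) \<ge> 2" by simp
        then have "has_repeat (m + x)" unfolding has_repeat_def by blast
        then show ?thesis using skew_has_repeat[OF sk E(2) mx] by simp
      next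
        case False
        then have "has_cycle (set_mset x)" using mono by simp
        then have "has_cycle (set_mset (m + x))" unfolding has_cycle_def by (simp, blast)
        then show ?thesis using OT_functional_has_cycle[OF \<nu> E(2) mx] by simp
      qed
      then show ?thesis using mono by (simp add: pr_c_mono)
    next
      case dep
      have dist: "distinct ps" using dep(4) by (simp add: distinct_map)
      have anti: "prod.swap e \<notin> set ps" if e: "e \<in> set ps" for e
      proof
        assume e': "prod.swap e \<in> set ps"
        have "prod.swap e \<noteq> e" using e dep(3) irrefl_swap[OF E(2)] by blast
        moreover have "inj_on (\<lambda>(i, j). {i, j}) (set ps)" using dep(4) by (simp add: distinct_map)
        moreover have "(\<lambda>(i, j). {i, j}) e = (\<lambda>(i, j). {i, j}) (prod.swap e)"
          by (simp add: case_prod_beta insert_commute)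
        ultimately show False using e e' by (metis inj_onD)
      qed
      \<comment> \<open>Moves the coefficients from list positions to edges; the position is unique
        because \<open>ps\<close> is distinct.\<close>
      define c where "c e = cs ! (THE p. p < length ps \<and> ps ! p = e)" for e
      have c: "c (ps ! p) = cs ! p" if "p < length ps" for p
      proof -
        have "(THE q. q < length ps \<and> ps ! q = ps ! p) = p"
          using that dist by (auto simp: nth_eq_iff_index_eq)
        then show ?thesis by (simp add: c_def)
      qed
      have reindex: "(\<Sum>p<length ps. cs ! p * g (ps ! p)) = (\<Sum>e\<in>set ps. c e * g e)" for g
      proof -
        have "bij_betw (\<lambda>p. ps ! p) {..<length ps} (set ps)" using dist by (rule bij_betw_nth) auto
        from sum.reindex_bij_betw[OF this, of "\<lambda>e. c e * g e"] show ?thesis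
          using c by simp
      qed
      have "pr s (\<lambda>x. \<nu> (m + x)) = (\<Sum>e\<in>set ps. c e * \<nu> (m + mset_set (set ps - {e})))"
        unfolding dep(1) pr_dependence_rel[OF dist] by (rule reindex)
      also have "\<dots> = 0"
      proof (rule OT_functional_dependence[OF \<nu> m _ dep(3) anti])
        show "(\<Sum>e\<in>set ps. c e * evec e x) = 0" for x
          using dep(5) reindex[of "\<lambda>e. evec e x"] by simp
      qed auto
      finally show ?thesis .
    qed
  qed
  from c_ideal_kill[of f E "OT_rels n E" \<nu> "{#}", OF _ OT_rels_fin this] f show ?thesis
    by (simp add: OT_ideal_def)
qed

lemma OT_functionalI:
  assumes kill: "\<And>f. f \<in> OT_ideal n E \<Longrightarrow> pr f \<nu> = 0" and E: "sym E" "irrefl E"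
  shows "OT_functional E \<nu>"
proof -
  have ctx: "pr s (\<lambda>x. \<nu> (m + x)) = 0" if "s \<in> OT_rels n E" "set_mset m \<subseteq> E" for s m
    using c_ideal_context[OF kill[unfolded OT_ideal_def] that(1) OT_rels_fin[OF that(1)] that(2)] .
  have skew: "skew E \<nu>"
    unfolding skew_def
  proof (intro conjI allI impI)
    fix m e assume m: "set_mset m \<subseteq> E" and e: "(e::edge) \<in> E"
    obtain i j where ij: "e = (i, j)" by fastforce
    have "c_add (c_mono {#(i, j)#}) (c_mono {#(j, i)#}) \<in> OT_rels n E"
      using e ij unfolding OT_rels_eq by blast
    from ctx[OF this m] show "\<nu> (add_mset (prod.swap e) m) = - \<nu> (add_mset e m)"
      by (simp add: ij pr_c_add pr_c_mono c_fin_mono)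
    have "has_repeat {#e, e#}" unfolding has_repeat_def by (intro exI[of _ i] exI[of _ j]) (auto simp: ij)
    then have "c_mono {#e, e#} \<in> OT_rels n E"
      using e unfolding OT_rels_eq by (intro UnI1 UnI2 CollectI exI[of _ "{#e, e#}"]) simp
    from ctx[OF this m] show "\<nu> (add_mset e (add_mset e m)) = 0"
      by (simp add: pr_c_mono)
  qed
  have core: "(\<Sum>e\<in>D. c e * \<nu> (m + mset_set (D - {e}))) = 0"
    if m: "set_mset m \<subseteq> E" and D: "finite D" "D \<subseteq> E" "\<And>e. e \<in> D \<Longrightarrow> prod.swap e \<notin> D"
      and bal: "\<And>x. (\<Sum>e\<in>D. c e * evec e x) = 0" for m D c
  proof -
    obtain ps where ps: "set ps = D" "distinct ps" using finite_distinct_list[OF D(1)] by blast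
    have reindex: "(\<Sum>p<length ps. map c ps ! p * g (ps ! p)) = (\<Sum>e\<in>D. c e * g e)" for g
    proof -
      have "bij_betw (\<lambda>p. ps ! p) {..<length ps} D" using ps by (intro bij_betw_nth) auto
      from sum.reindex_bij_betw[OF this, of "\<lambda>e. c e * g e"] show ?thesis by simp
    qed
    have "inj_on (\<lambda>(i, j). {i, j}) D"
      using D(3) by (auto intro!: inj_onI simp: doubleton_eq_iff)
    then have "distinct (map (\<lambda>(i, j). {i, j}) ps)" using ps by (simp add: distinct_map)
    moreover have "(\<Sum>p<length ps. map c ps ! p * evec (ps ! p) v) = 0" for v
      using reindex[of "\<lambda>e. evec e v"] bal[of v] by simp
    ultimately have "dependence_rel ps (map c ps) \<in> OT_rels n E"
      using ps(1) D(2) unfolding OT_rels_eq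
      by (intro UnI2 CollectI exI[of _ ps] exI[of _ "map c ps"] conjI allI refl) simp_all
    from ctx[OF this m] show ?thesis
      unfolding pr_dependence_rel[OF ps(2)] ps(1) reindex[of "\<lambda>e. \<nu> (m + mset_set (D - {e}))"] .
  qed
  show ?thesis
    unfolding OT_functional_def by (intro conjI allI impI skew) (rule core; simp)
qed

section \<open>Residues as functionals\<close>

text \<open>The test \<open>m = mset_set (set_mset m)\<close> says that \<open>m\<close> is
  squarefree. The value 0 elsewhere imposes \<open>x_ij^2 = 0\<close>, which the substitution by
  rational functions would violate.\<close>

definition mres :: "edge list \<Rightarrow> edge multiset \<Rightarrow> rat" where
  "mres bs m = (if m = mset_set (set_mset m) then residue evec bs (set_mset m) else 0)"

lemma mres_mset_set: "finite T \<Longrightarrow> mres bs (mset_set T) = residue evec bs T"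
  by (simp add: mres_def)

lemma add_mset_eq_mset_set:
  "add_mset e m = mset_set (insert e (set_mset m)) \<longleftrightarrow> e \<notin># m \<and> m = mset_set (set_mset m)"
proof (cases "e \<in># m")
  case True
  have "add_mset e m \<noteq> mset_set (insert e (set_mset m))"
  proof
    assume "add_mset e m = mset_set (insert e (set_mset m))"
    from arg_cong[OF this, of "\<lambda>m. count m e"] have "count m e = 0" by (simp add: count_mset_set)
    with True show False by (simp add: count_eq_zero_iff)
  qed
  with True show ?thesis by blast
qed simp

lemma mres_add:
  "mres bs (add_mset e m) = (if e \<in># m then 0 else if m = mset_set (set_mset m)
     then residue evec bs (insert e (set_mset m)) else 0)"
  by (simp add: mres_def add_mset_eq_mset_set)

lemma residue_dependent_subset:
  assumes "finite T" "X \<subseteq> T" "\<And>x. (\<Sum>t\<in>X. c t * \<alpha> t x) = 0" "t \<in> X" "c t \<noteq> 0"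
  shows "residue \<alpha> bs T = 0"
proof (rule residue_dependent)
  show "(\<Sum>t\<in>T. (if t \<in> X then c t else 0) * \<alpha> t x) = 0" for x
    using assms(1,2) assms(3)[of x] by (subst sum.mono_neutral_right[of T X]) auto
qed (use assms in auto)

lemma residue_antiparallel:
  assumes "finite T" "(i, j) \<in> T" "(j, i) \<in> T" "i \<noteq> j"
  shows "residue evec bs T = 0"
  by (rule residue_dependent_subset[of _ "{(i, j), (j, i)}" "\<lambda>_. 1" _ "(i, j)"])
    (use assms in \<open>auto simp: evec_def\<close>)

lemma residue_triangle:
  assumes "finite T" "(i, j) \<in> T" "(j, k) \<in> T" "(k, i) \<in> T" "distinct [i, j, k]"
  shows "residue evec bs T = 0"
  by (rule residue_dependent_subset[of _ "{(i, j), (j, k), (k, i)}" "\<lambda>_. 1" _ "(i, j)"])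
    (use assms in \<open>auto simp: evec_def\<close>)

text \<open>Commutation holds because only the multiset counts. Flip and triangle are
  \<open>residue_flip\<close> and \<open>residue_three_term\<close> when the variables involved are
  new to the monomial. Otherwise each term either has a square or contains a full dependent set, an
  antiparallel pair or a triangle.\<close>

lemma mres_FK_functional: "FK_functional n (\<lambda>w. mres bs (mset w))"
  unfolding FK_functional_iff
proof (intro allI impI conjI, goal_cases)
  case (1 u v i j)
  let ?m = "mset u + mset v" and ?T = "set u \<union> set v"
  have ij: "i \<noteq> j" using 1 by (auto simp: FK_vars_def)
  have "mres bs (add_mset (i, j) ?m) + mres bs (add_mset (j, i) ?m) = 0"
  proof (cases "?m = mset_set ?T \<and> (i, j) \<notin> ?T \<and> (j, i) \<notin> ?T")
    case True
    then show ?thesis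
      using residue_flip[of ?T "(i, j)" "(j, i)" evec bs] evec_swap[of "(j, i)"] by (simp add: mres_add)
  next
    case False
    then show ?thesis
      using residue_antiparallel[of "insert (i, j) ?T" i j bs] residue_antiparallel[of "insert (j, i) ?T" i j bs] ij
      by (auto simp: mres_add)
  qed
  then show ?case by simp
next
  case (2 u v i j)
  then show ?case by (simp add: mres_add)
next
  case (3 u v i j k l)
  then show ?case by (simp add: add_mset_commute)
next
  case (4 u v i j k)
  let ?m = "mset u + mset v" and ?T = "set u \<union> set v"
  let ?p = "(i, j)" and ?q = "(j, k)" and ?r = "(k, i)"
  have d: "distinct [i, j, k]" "?p \<noteq> ?q" "?q \<noteq> ?r" "?p \<noteq> ?r" using 4 by auto
  have two: "mres bs (add_mset a (add_mset b ?m)) = (if a \<in> ?T \<or> b \<in> ?T then 0 else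
      if ?m = mset_set ?T then residue evec bs (insert a (insert b ?T)) else 0)" if "a \<noteq> b" for a b
    using that add_mset_eq_mset_set[of b ?m] by (auto simp: mres_add)
  have tri: "residue evec bs (insert a (insert b ?T)) = 0"
    if "{?p, ?q, ?r} \<subseteq> insert a (insert b ?T)" for a b
    using that d(1) by (intro residue_triangle[of _ i j k]) auto
  have "mres bs (add_mset ?p (add_mset ?q ?m)) + mres bs (add_mset ?q (add_mset ?r ?m))
      + mres bs (add_mset ?r (add_mset ?p ?m)) = 0"
  proof (cases "?m = mset_set ?T \<and> ?p \<notin> ?T \<and> ?q \<notin> ?T \<and> ?r \<notin> ?T")
    case True
    have "evec ?p x + evec ?q x + evec ?r x = 0" for x by (simp add: evec_def)
    then show ?thesis
      using residue_three_term[of ?T ?p ?q ?r evec bs] True d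
      unfolding two[OF d(2)] two[OF d(3)] two[OF d(4)[symmetric]] by simp
  next
    case False
    then show ?thesis
      unfolding two[OF d(2)] two[OF d(3)] two[OF d(4)[symmetric]]
      using tri[of ?p ?q] tri[of ?q ?r] tri[of ?r ?p] by auto
  qed
  then show ?case by (simp add: add_mset_commute)
qed

lemma FK_vars_mono:
  assumes "E \<subseteq> {1..n} \<times> {1..n}" "irrefl E"
  shows "E \<subseteq> FK_vars n"
  using assms by (auto simp: FK_vars_def irrefl_def)

text \<open>Serves both inclusions: once for a separating functional that is symmetric only on words
  over \<open>E\<close>, once for the residues.\<close>

lemma FK_imp_cyclic_functional:
  assumes \<mu>: "FK_functional n \<mu>" and E: "E \<subseteq> {1..n} \<times> {1..n}" "irrefl E" "sym E"
    and \<nu>: "\<And>w. set w \<subseteq> E \<Longrightarrow> \<mu> w = \<nu> (mset w)"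
  shows "cyclic_functional E \<nu>"
  unfolding cyclic_functional_def skew_def
proof (intro conjI allI impI)
  note EV = FK_vars_mono[OF E(1,2)]
  fix m :: "edge multiset" assume m: "set_mset m \<subseteq> E"
  obtain u where u: "mset u = m" using ex_mset by blast
  then have uE: "set u \<subseteq> E" using m by auto
  {
    fix e assume e: "(e::edge) \<in> E"
    obtain i j where ij: "e = (i, j)" by fastforce
    have e': "(j, i) \<in> E" using e ij E(3) by (auto dest: symD)
    have "\<mu> (u @ [(j, i)]) = - \<mu> (u @ [(i, j)])"
      using FK_flip[OF \<mu>, of u "[]" i j] uE EV e ij by auto
    then show "\<nu> (add_mset (prod.swap e) m) = - \<nu> (add_mset e m)"
      using \<nu>[of "u @ [(j, i)]"] \<nu>[of "u @ [(i, j)]"] uE e e' ij u by simp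
    have "\<mu> (u @ [(i, j), (i, j)]) = 0"
      using FK_square[OF \<mu>, of u "[]" i j] uE EV e ij by auto
    then show "\<nu> (add_mset e (add_mset e m)) = 0"
      using \<nu>[of "u @ [(i, j), (i, j)]"] uE e ij u by simp
  }
  fix vs :: "nat list" assume vs: "distinct vs" "3 \<le> length vs" "set (cyc vs) \<subseteq> E"
  have vsn: "set vs \<subseteq> {1..n}"
  proof
    fix x assume "x \<in> set vs"
    then obtain i where "i < length vs" "vs ! i = x" by (meson in_set_conv_nth)
    then have "fst (cyc vs ! i) = x" "cyc vs ! i \<in> set (cyc vs)"
      by (simp add: nth_cyc, metis length_cyc nth_mem)
    moreover from this have "cyc vs ! i \<in> {1..n} \<times> {1..n}" using vs(3) E(1) by blast
    ultimately show "x \<in> {1..n}" by (metis mem_Times_iff)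
  qed
  show "(\<Sum>e\<in>set (cyc vs). \<nu> (m + mset_set (set (cyc vs) - {e}))) = 0"
    unfolding u[symmetric]
  proof (rule FK_cycle_mset[OF \<mu> _ vs(1) vsn vs(2)])
    show "set u \<subseteq> FK_vars n" using uE EV by blast
    show "\<mu> w = \<nu> (mset w)" if "set w \<subseteq> set u \<union> set (cyc vs)" for w
      using that uE vs(3) by (intro \<nu>) blast
  qed
qed

text \<open>A dependence of \<open>e\<close> on larger elements of \<open>S\<close> rewrites the monomial of \<open>S\<close> in terms of sets in which
  one of these elements is replaced by \<open>e\<close>, so the sum of the codes decreases.\<close>
lemma OT_functional_eq_0:
  assumes \<delta>: "OT_functional E \<delta>" and E: "sym E" "irrefl E"
    and nbc: "\<And>S. finite S \<Longrightarrow> S \<subseteq> {(i, j) \<in> E. i < j} \<Longrightarrow> nbc evec {(i, j) \<in> E. i < j} S \<Longrightarrow> \<delta> (mset_set S) = 0"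
    and m: "set_mset m \<subseteq> E"
  shows "\<delta> m = 0"
proof -
  let ?E = "{(i, j) \<in> E. i < j}"
  let ?r = prod_encode
  have sk: "skew E \<delta>" using \<delta> by (simp add: OT_functional_def)
  have set: "\<delta> (mset_set S) = 0" if "finite S" "S \<subseteq> ?E" for S
    using that
  proof (induction "sum ?r S" arbitrary: S rule: less_induct)
    case less
    show ?case
    proof (cases "nbc evec ?E S")
      case True
      then show ?thesis using nbc less.prems by blast
    next
      case False
      then obtain e c where e: "e \<in> ?E" and c: "\<And>x. evec e x = (\<Sum>s\<in>{s\<in>S. ?r e < ?r s}. c s * evec s x)"
        unfolding nbc_def in_span_def by blast
      let ?S = "{s\<in>S. ?r e < ?r s}"
      let ?D = "insert e S"
      define c' where "c' s = (if s = e then -1 else if s \<in> ?S then c s else 0)" for s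
      have DE: "?D \<subseteq> ?E" using less.prems e by blast
      have lt: "fst s < snd s" "s \<in> E" if "s \<in> ?D" for s
        using subsetD[OF DE that] by (simp_all add: case_prod_beta)
      have D: "finite ?D" "?D \<subseteq> E" "\<And>e. e \<in> ?D \<Longrightarrow> prod.swap e \<notin> ?D"
      proof -
        show "finite ?D" using less.prems(1) by simp
        show "?D \<subseteq> E" using lt(2) by blast
        show "prod.swap s \<notin> ?D" if "s \<in> ?D" for s
          using lt(1)[OF that] lt(1)[of "prod.swap s"] by (metis fst_swap not_less_iff_gr_or_eq snd_swap)
      qed
      have "(\<Sum>s\<in>?D. c' s * evec s x) = 0" for x
      proof -
        have "(\<Sum>s\<in>?D. c' s * evec s x) = - evec e x + (\<Sum>s\<in>?D - {e}. c' s * evec s x)"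
          using D(1) by (subst sum.remove[of _ e]) (auto simp: c'_def)
        also have "(\<Sum>s\<in>?D - {e}. c' s * evec s x) = (\<Sum>s\<in>?S. c s * evec s x)"
          using less.prems by (intro sum.mono_neutral_cong_right) (auto simp: c'_def)
        finally show ?thesis using c[of x] by simp
      qed
      note bal = this
      show ?thesis
      \<comment> \<open>If \<open>e\<close> lies in \<open>S\<close>, then \<open>S\<close> itself
        is dependent and its monomial vanishes. Otherwise the term of the dependence that omits
        \<open>e\<close> is the monomial of \<open>S\<close>, with coefficient -1.\<close>
      proof (cases "e \<in> S")
        case True
        then have "?D = S" by auto
        then show ?thesis using True OT_functional_dependent[OF \<delta> D bal, of e] by (simp add: c'_def)
      next
        case False
        have "0 = (\<Sum>s\<in>?D. c' s * \<delta> ({#} + mset_set (?D - {s})))"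
          by (rule OT_functional_dependence[OF \<delta> _ D bal, symmetric]) simp
        also have "\<dots> = - \<delta> (mset_set S) + (\<Sum>s\<in>S. c' s * \<delta> (mset_set (?D - {s})))"
          using False less.prems by (simp add: c'_def)
        also have "(\<Sum>s\<in>S. c' s * \<delta> (mset_set (?D - {s}))) = 0"
        proof (intro sum.neutral ballI)
          fix s assume s: "s \<in> S"
          show "c' s * \<delta> (mset_set (?D - {s})) = 0"
          proof (cases "?r e < ?r s")
            case True
            have "?D - {s} = insert e (S - {s})" using False s by auto
            then have "sum ?r (?D - {s}) = ?r e + sum ?r (S - {s})" using False less.prems by simp
            also have "\<dots> < ?r s + sum ?r (S - {s})" using True by simp
            also have "\<dots> = sum ?r S" using s less.prems by (simp add: sum.remove)
            finally have "\<delta> (mset_set (?D - {s})) = 0"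
              by (rule less.hyps) (use less.prems e in auto)
            then show ?thesis by simp
          next
            case 2: False
            then have "c' s = 0" using s False by (auto simp: c'_def)
            then show ?thesis by simp
          qed
        qed
        finally show ?thesis by simp
      qed
    qed
  qed
  \<comment> \<open>Orienting every edge upwards changes the value only by a sign and reduces a
    general monomial to a repeated one or to a set inside \<open>?E\<close>.\<close>
  define f :: "edge \<Rightarrow> edge" where "f e = (if fst e < snd e then e else prod.swap e)" for e
  have f: "f e = e \<or> f e = prod.swap e" for e by (simp add: f_def)
  have fE: "f e \<in> ?E" if "e \<in> E" for e
  proof -
    have "fst e \<noteq> snd e" using irrefl_swap[OF E(2) that] by (metis prod.collapse swap_simp)
    moreover have "prod.swap e \<in> E" using sym_swap[OF E(1)] that by blast
    ultimately show ?thesis using that by (auto simp: f_def case_prod_beta)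
  qed
  let ?m = "image_mset f m"
  have mE: "set_mset ?m \<subseteq> ?E" 
    unfolding set_image_mset by (rule image_subsetI) (rule fE, rule subsetD[OF m])
  then have mE': "set_mset ?m \<subseteq> E" by auto
  have "\<delta> ?m = 0"
  proof (cases "has_repeat ?m")
    case True
    then show ?thesis using skew_has_repeat[OF sk E(2) mE'] by simp
  next
    case False
    show ?thesis
      by (subst no_repeat_mset_set(1)[OF False]) (rule set[OF finite_set_mset mE])
  qed
  moreover have "\<delta> ({#} + ?m) = (\<Prod>e\<in>#m. if f e = e then 1 else -1) * \<delta> ({#} + m)"
    by (rule skew_orient[OF sk E(1) f]) (use m in auto)
  moreover have "(\<Prod>e\<in>#m. if f e = e then 1 else -1 :: rat) \<noteq> 0"
    by (induction m) auto
  ultimately show ?thesis by simp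
qed

section \<open>The two inclusions\<close>

abbreviation comm_ideal :: "edge set \<Rightarrow> ncpoly set" where
  "comm_ideal E \<equiv> nc_ideal E {nc_comm a b | a b. nc_over E a \<and> nc_over E b}"

lemma nc_mul_mono_Nil_right: "nc_mul p (nc_mono []) = p"
proof
  fix w
  have "nc_mul p (nc_mono []) w = (\<Sum>k\<in>{length w}. p (take k w) * nc_mono [] (drop k w))"
    unfolding nc_mul_def by (rule sum.mono_neutral_right) (auto simp: nc_mono_def)
  then show "nc_mul p (nc_mono []) w = p w" by (simp add: nc_mono_def)
qed

lemma nc_mul_const_left: "nc_mul (\<lambda>w. if w = [] then c else 0) p = (\<lambda>w. c * p w)"
proof
  fix w
  have "nc_mul (\<lambda>w. if w = [] then c else 0) p w
      = (\<Sum>k\<in>{0}. (if take k w = [] then c else 0) * p (drop k w))"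
    unfolding nc_mul_def by (rule sum.mono_neutral_right) auto
  then show "nc_mul (\<lambda>w. if w = [] then c else 0) p w = c * p w" by simp
qed

text \<open>The inductive ideal has no rule for scalars; they enter as constant polynomials. Closure
  under scaling is what \<open>separating_functional\<close> asks for.\<close>

lemma nc_ideal_scale:
  assumes "p \<in> nc_ideal V S" shows "(\<lambda>w. c * p w) \<in> nc_ideal V S"
proof -
  have "nc_mul (nc_mul (\<lambda>w. if w = [] then c else 0) p) (nc_mono []) \<in> nc_ideal V S"
    using assms by (intro nc_ideal.mul nc_over_mono) (auto simp: nc_over_def nc_fin_def)
  then show ?thesis by (simp add: nc_mul_mono_Nil_right nc_mul_const_left)
qed

lemma c_mul_const_left: "c_mul (\<lambda>m. if m = {#} then c else 0) p = (\<lambda>m. c * p m)"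
proof
  fix m :: "edge multiset"
  have "finite {a. a \<subseteq># m}" by (rule finite_submset)
  then have "c_mul (\<lambda>m. if m = {#} then c else 0) p m
      = (\<Sum>a\<in>{{#}}. (if a = {#} then c else 0) * p (m - a))"
    unfolding c_mul_def by (intro sum.mono_neutral_right) auto
  then show "c_mul (\<lambda>m. if m = {#} then c else 0) p m = c * p m" by simp
qed

lemma c_ideal_scale:
  assumes "p \<in> c_ideal V S" shows "(\<lambda>m. c * p m) \<in> c_ideal V S"
proof -
  have "c_mul (\<lambda>m. if m = {#} then c else 0) p \<in> c_ideal V S"
    using assms by (intro c_ideal.mul) (auto simp: c_over_def c_fin_def)
  then show ?thesis by (simp add: c_mul_const_left)
qed

lemma comm_ideal_gen_fin: "s \<in> {nc_comm a b | a b. nc_over E a \<and> nc_over E b} \<Longrightarrow> nc_fin s"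
  by (auto intro: nc_fin_comm nc_over_fin)

lemma pr_comm_ideal:
  assumes "q \<in> comm_ideal E"
  shows "pr q (\<lambda>w. \<nu> (mset w)) = 0"
proof -
  have "pr s (\<lambda>w. \<nu> (mset (u @ w @ v))) = 0" if "s \<in> {nc_comm a b | a b. nc_over E a \<and> nc_over E b}" for s u v
  proof -
    from that obtain a b where s: "s = nc_comm a b" and ab: "nc_fin a" "nc_fin b"
      by (auto intro: nc_over_fin)
    have "pr (nc_mul a b) (\<lambda>w. \<nu> (mset (u @ w @ v))) = pr (nc_mul b a) (\<lambda>w. \<nu> (mset (u @ w @ v)))"
      unfolding pr_nc_mul[OF ab] pr_nc_mul[OF ab(2,1)]
      by (subst pr_commute) (simp add: add_ac)
    then show ?thesis using ab by (simp add: s nc_comm_def pr_nc_sub nc_fin_mul)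
  qed
  from nc_ideal_kill[of q E _ "\<lambda>w. \<nu> (mset w)" "[]" "[]", OF assms comm_ideal_gen_fin this] show ?thesis
    by simp
qed

text \<open>Induction on \<open>w\<close>: its first letter is pulled to the front of
  \<open>w'\<close> by a commutator of two words and then absorbed into the prefix \<open>u\<close>.
  \<open>pr_comm_ideal\<close> is the converse.\<close>

lemma comm_ideal_kill_symmetric:
  assumes kill: "\<And>q. q \<in> comm_ideal E \<Longrightarrow> pr q \<mu> = 0"
    and "set w \<subseteq> E" "mset w' = mset w" "set u \<subseteq> E"
  shows "\<mu> (u @ w') = \<mu> (u @ w)"
  using assms(2-)
proof (induction w arbitrary: w' u)
  case Nil
  then show ?case by simp
next
  case (Cons a w)
  have "a \<in> set w'" using Cons.prems(2) by (metis list.set_intros(1) mset_eq_setD)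
  then obtain x y where w': "w' = x @ a # y" by (meson split_list)
  have xy: "mset (x @ y) = mset w" using Cons.prems(2) w' by simp
  have sub: "set x \<subseteq> E" "set y \<subseteq> E" "a \<in> E"
    using mset_eq_setD[OF Cons.prems(2)] Cons.prems(1) w' by auto
  let ?s = "nc_comm (nc_mono x) (nc_mono [a])"
  have "nc_over E (nc_mono x)" "nc_over E (nc_mono [a])" using sub by (auto intro: nc_over_mono)
  then have s: "?s \<in> {nc_comm a b | a b. nc_over E a \<and> nc_over E b}" by blast
  have "pr ?s (\<lambda>w. \<mu> (u @ w @ y)) = 0"
    by (rule nc_ideal_context[OF kill s comm_ideal_gen_fin[OF s] Cons.prems(3) sub(2)])
  then have "\<mu> (u @ x @ [a] @ y) = \<mu> (u @ [a] @ x @ y)"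
    by (simp add: nc_comm_def pr_nc_sub pr_nc_mul pr_nc_mono nc_fin_intros)
  also have "\<dots> = \<mu> ((u @ [a]) @ (x @ y))" by simp
  also have "\<dots> = \<mu> ((u @ [a]) @ w)"
    by (rule Cons.IH) (use Cons.prems sub xy in auto)
  finally show ?case by (simp add: w')
qed

text \<open>The kernel consists of the polynomials over \<open>E\<close> in the sum \<open>K\<close>
  of the two ideals. A functional separating \<open>p\<close> from \<open>K\<close> is at once a
  Fomin--Kirillov functional and symmetric on words over \<open>E\<close>, hence descends to an
  Orlik--Terao functional and kills \<open>ab p\<close>.\<close>

lemma OT_ideal_sub_kernel:
  assumes E: "E \<subseteq> {1..n} \<times> {1..n}" "sym E" "irrefl E"
    and p: "nc_over E p" "ab p \<in> OT_ideal n E"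
  shows "p \<in> FK_ab_kernel n E"
proof (rule ccontr)
  assume notin: "p \<notin> FK_ab_kernel n E"
  define K where "K = {nc_add q r | q r. q \<in> comm_ideal E \<and> r \<in> FK_ideal n}"
  have qfin: "nc_fin q" if "q \<in> comm_ideal E" for q
    using nc_ideal_fin[OF that comm_ideal_gen_fin] .
  have rfin: "nc_fin r" if "r \<in> FK_ideal n" for r
    using nc_ideal_fin[OF that[unfolded FK_ideal_def] FK_rels_fin] .
  have inK: "nc_add q r \<in> K" if "q \<in> comm_ideal E" "r \<in> FK_ideal n" for q r
    using that unfolding K_def by blast
  have z: "nc_zero \<in> comm_ideal E" "nc_zero \<in> FK_ideal n"
    unfolding FK_ideal_def by (rule nc_ideal.zero)+
  have pK: "p \<notin> K"
  proof
    assume "p \<in> K"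
    then obtain q r where qr: "p = nc_add q r" "q \<in> comm_ideal E" "r \<in> FK_ideal n" unfolding K_def by blast
    have "nc_sub p q = r" by (auto simp: qr(1) nc_sub_def nc_add_def)
    then have "\<exists>q\<in>comm_ideal E. nc_sub p q \<in> FK_ideal n" using qr by blast
    with p(1) notin show False unfolding FK_ab_kernel_def by simp
  qed
  have K0: "(\<lambda>_. 0) \<in> K" using inK[OF z] by (simp add: nc_add_def nc_zero_def)
  have Kadd: "(\<lambda>x. f x + g x) \<in> K" if fg: "f \<in> K" "g \<in> K" for f g
  proof -
    from fg obtain q r q' r' where *: "f = nc_add q r" "g = nc_add q' r'" "q \<in> comm_ideal E" "r \<in> FK_ideal n"
      "q' \<in> comm_ideal E" "r' \<in> FK_ideal n" unfolding K_def by blast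
    have "nc_add (nc_add q q') (nc_add r r') \<in> K"
      using * by (intro inK nc_ideal.add) (auto simp: FK_ideal_def intro: nc_ideal.add)
    moreover have "nc_add (nc_add q q') (nc_add r r') = (\<lambda>x. f x + g x)"
      using * by (auto simp: nc_add_def)
    ultimately show ?thesis by simp
  qed
  have Kscale: "(\<lambda>x. c * f x) \<in> K" if f: "f \<in> K" for f c
  proof -
    from f obtain q r where *: "f = nc_add q r" "q \<in> comm_ideal E" "r \<in> FK_ideal n" unfolding K_def by blast
    have "nc_add (\<lambda>x. c * q x) (\<lambda>x. c * r x) \<in> K"
      using * by (intro inK) (auto simp: FK_ideal_def intro: nc_ideal_scale)
    moreover have "nc_add (\<lambda>x. c * q x) (\<lambda>x. c * r x) = (\<lambda>x. c * f x)"
      using * by (auto simp: nc_add_def distrib_left)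
    ultimately show ?thesis by simp
  qed
  have Kfin: "finite {x. f x \<noteq> 0}" if "f \<in> K" for f
    using that qfin rfin nc_fin_add unfolding K_def nc_fin_def[symmetric] by blast
  have pfin: "finite {x. p x \<noteq> 0}" using nc_over_fin[OF p(1)] by (simp add: nc_fin_def)
  obtain \<mu> where \<mu>: "\<And>f. f \<in> K \<Longrightarrow> pr f \<mu> = 0" "pr p \<mu> \<noteq> 0"
    by (rule separating_functional[OF K0 Kadd Kscale Kfin pfin pK]) blast+
  have killq: "pr q \<mu> = 0" if "q \<in> comm_ideal E" for q
  proof -
    have "nc_add q nc_zero = q" by (simp add: nc_add_def nc_zero_def)
    then show ?thesis using \<mu>(1)[OF inK[OF that z(2)]] by simp
  qed
  have killr: "pr r \<mu> = 0" if "r \<in> FK_ideal n" for r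
  proof -
    have "nc_add nc_zero r = r" by (simp add: nc_add_def nc_zero_def)
    then show ?thesis using \<mu>(1)[OF inK[OF z(1) that]] by simp
  qed
  \<comment> \<open>Any listing of \<open>m\<close> will do: over \<open>E\<close> the value of
    \<open>\<mu>\<close> does not depend on the order of the letters.\<close>
  define \<nu> where "\<nu> m = \<mu> (SOME w. mset w = m)" for m
  have \<nu>: "\<mu> w = \<nu> (mset w)" if "set w \<subseteq> E" for w
  proof -
    have "mset (SOME w'. mset w' = mset w) = mset w" by (rule someI_ex) auto
    from comm_ideal_kill_symmetric[OF killq that this, of "[]"] show ?thesis by (simp add: \<nu>_def)
  qed
  have "FK_functional n \<mu>" using killr by (rule FK_functionalI)
  then have "cyclic_functional E \<nu>"
    by (rule FK_imp_cyclic_functional[OF _ E(1,3,2)]) (rule \<nu>)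
  then have "OT_functional E \<nu>" using E(2) by (rule cyclic_imp_OT_functional)
  then have "pr (ab p) \<nu> = 0" using OT_functional_kill E p(2) by blast
  then have "pr p (\<lambda>w. \<nu> (mset w)) = 0" using pr_ab[OF nc_over_fin[OF p(1)]] by simp
  moreover have "pr p \<mu> = pr p (\<lambda>w. \<nu> (mset w))"
    using p(1) \<nu> by (intro pr_cong) (auto simp: nc_over_def)
  ultimately show False using \<mu>(2) by simp
qed

text \<open>Residues kill both ideals and therefore \<open>ab p\<close>. It remains to see that on
  monomials over \<open>E\<close> every Orlik--Terao functional is a combination of residues, so
  that none can separate \<open>ab p\<close> from the ideal.\<close>

lemma kernel_sub_OT_ideal:
  assumes E: "E \<subseteq> {1..n} \<times> {1..n}" "sym E" "irrefl E"
    and p: "p \<in> FK_ab_kernel n E"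
  shows "ab p \<in> OT_ideal n E"
proof (rule ccontr)
  assume notin: "ab p \<notin> OT_ideal n E"
  from p obtain q where pE: "nc_over E p" and q: "q \<in> comm_ideal E" "nc_sub p q \<in> FK_ideal n"
    unfolding FK_ab_kernel_def by blast
  have fin: "nc_fin p" "nc_fin q"
    using nc_over_fin[OF pE] nc_ideal_fin[OF q(1) comm_ideal_gen_fin] by auto
  have res0: "pr (ab p) (mres bs) = 0" for bs
  proof -
    have "pr (nc_sub p q) (\<lambda>w. mres bs (mset w)) = 0"
      using FK_functional_kill[OF mres_FK_functional q(2)] .
    then have "pr p (\<lambda>w. mres bs (mset w)) = 0"
      using pr_comm_ideal[OF q(1)] by (simp add: pr_nc_sub fin)
    then show ?thesis by (simp add: pr_ab fin)
  qed
  have res_OT: "OT_functional E (mres bs)" for bs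
    by (rule cyclic_imp_OT_functional[OF FK_imp_cyclic_functional[OF mres_FK_functional[of n bs] E(1,3,2)] E(2)])
      (rule refl)
  obtain \<nu> where \<nu>: "\<And>f. f \<in> OT_ideal n E \<Longrightarrow> pr f \<nu> = 0" "pr (ab p) \<nu> \<noteq> 0"
  proof (rule separating_functional[of "OT_ideal n E" "ab p"])
    show "(\<lambda>_. 0) \<in> OT_ideal n E"
      using c_ideal.zero unfolding OT_ideal_def c_zero_def .
    show "(\<lambda>x. f x + g x) \<in> OT_ideal n E" if "f \<in> OT_ideal n E" "g \<in> OT_ideal n E" for f g
      using c_ideal.add[of f E "OT_rels n E" g] that unfolding OT_ideal_def c_add_def by blast
    show "(\<lambda>x. c * f x) \<in> OT_ideal n E" if "f \<in> OT_ideal n E" for f c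
      using that c_ideal_scale unfolding OT_ideal_def by blast
    show "finite {x. f x \<noteq> 0}" if "f \<in> OT_ideal n E" for f
      using c_ideal_fin[of f E "OT_rels n E"] OT_rels_fin that unfolding OT_ideal_def c_fin_def by blast
    show "finite {x. ab p x \<noteq> 0}"
    proof (rule finite_subset)
      show "{x. ab p x \<noteq> 0} \<subseteq> mset ` {w. p w \<noteq> 0}" by (auto elim!: ab_supp)
    qed (use fin in \<open>auto simp: nc_fin_def\<close>)
  qed (use notin in auto)
  have \<nu>_OT: "OT_functional E \<nu>" using OT_functionalI[OF \<nu>(1)] E by blast
  let ?E = "{(i, j) \<in> E. i < j}"
  have finE: "finite ?E"
    by (rule finite_subset[of _ "{1..n} \<times> {1..n}"]) (use E(1) in auto)
  define N where "N = {S. S \<subseteq> ?E \<and> nbc evec ?E S}"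
  have finN: "finite N" by (rule finite_subset[of _ "Pow ?E"]) (use finE in \<open>auto simp: N_def\<close>)
  \<comment> \<open>Largest edge first, the order of residues for which \<open>residue_nbc\<close>
    gives the identity matrix.\<close>
  define desc :: "edge set \<Rightarrow> edge list" where
    "desc S = rev (map prod_decode (sorted_list_of_set (prod_encode ` S)))" for S
  have desc: "sorted_wrt (\<lambda>x y. prod_encode y < prod_encode x) (desc S)" "set (desc S) = S" if "finite S" for S
    using that by (simp_all add: desc_def sorted_wrt_rev sorted_wrt_map image_image)
  \<comment> \<open>The expansion of \<open>\<nu>\<close> in the dual basis is subtracted. The
    difference vanishes on monomials without broken circuits, hence on all monomials over
    \<open>E\<close> by \<open>OT_functional_eq_0\<close>.\<close>
  define \<delta> where "\<delta> m = \<nu> m - (\<Sum>S\<in>N. \<nu> (mset_set S) * mres (desc S) m)" for m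
  have \<delta>_nbc: "\<delta> (mset_set T) = 0" if T: "finite T" "T \<subseteq> ?E" "nbc evec ?E T" for T
  proof -
    have "mres (desc S) (mset_set T) = (if T = S then 1 else 0)" if S: "S \<in> N" for S
    proof -
      have finS: "finite S" using S finE finite_subset by (auto simp: N_def)
      have "residue evec (desc S) T = (if T = set (desc S) then 1 else 0)"
        by (rule residue_nbc[where E = ?E]) (use desc[OF finS] S T in \<open>auto simp: N_def\<close>)
      then show ?thesis using desc[OF finS] T(1) by (simp add: mres_mset_set)
    qed
    then have "(\<Sum>S\<in>N. \<nu> (mset_set S) * mres (desc S) (mset_set T)) = (\<Sum>S\<in>N. if T = S then \<nu> (mset_set S) else 0)"
      by (intro sum.cong) auto
    also have "\<dots> = \<nu> (mset_set T)" using T finN by (simp add: N_def)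
    finally show ?thesis by (simp add: \<delta>_def)
  qed
  have \<delta>_OT: "OT_functional E \<delta>"
    unfolding OT_functional_def skew_def
  proof (intro conjI allI impI)
    fix m :: "edge multiset" assume m: "set_mset m \<subseteq> E"
    {
      fix e :: edge assume e: "e \<in> E"
      have sk: "skew E \<nu>" "\<And>bs. skew E (mres bs)" using \<nu>_OT res_OT by (auto simp: OT_functional_def)
      show "\<delta> (add_mset (prod.swap e) m) = - \<delta> (add_mset e m)"
        unfolding \<delta>_def using skew_swap[OF sk(1) m e] skew_swap[OF sk(2) m e] by (simp add: sum_negf)
      have ee: "set_mset (add_mset e (add_mset e m)) \<subseteq> E" "count (add_mset e (add_mset e m)) e \<ge> 2"
        using e m by auto
      show "\<delta> (add_mset e (add_mset e m)) = 0"
        unfolding \<delta>_def skew_repeat[OF sk(1) ee] skew_repeat[OF sk(2) ee] by simp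
    }
    fix D :: "edge set" and c
    assume D: "finite D" "D \<subseteq> E" "\<forall>e\<in>D. prod.swap e \<notin> D" "\<forall>x. (\<Sum>e\<in>D. c e * evec e x) = 0"
    have dep: "(\<Sum>e\<in>D. c e * \<phi> (m + mset_set (D - {e}))) = 0" if "OT_functional E \<phi>" for \<phi>
      by (rule OT_functional_dependence[OF that m]) (use D in auto)
    have "(\<Sum>e\<in>D. c e * \<delta> (m + mset_set (D - {e}))) = (\<Sum>e\<in>D. c e * \<nu> (m + mset_set (D - {e})))
        - (\<Sum>S\<in>N. \<nu> (mset_set S) * (\<Sum>e\<in>D. c e * mres (desc S) (m + mset_set (D - {e}))))"
      unfolding \<delta>_def right_diff_distrib sum_subtractf sum_distrib_left
      by (subst sum.swap[of _ N]) (simp add: mult_ac)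
    also have "\<dots> = 0" using dep[OF \<nu>_OT] dep[OF res_OT] by simp
    finally show "(\<Sum>e\<in>D. c e * \<delta> (m + mset_set (D - {e}))) = 0" .
  qed
  have "\<nu> m = (\<Sum>S\<in>N. \<nu> (mset_set S) * mres (desc S) m)" if "set_mset m \<subseteq> E" for m
    using OT_functional_eq_0[OF \<delta>_OT E(2,3) \<delta>_nbc that] by (simp add: \<delta>_def)
  moreover have "set_mset m \<subseteq> E" if "ab p m \<noteq> 0" for m
    using ab_supp[OF that] pE unfolding nc_over_def by (metis set_mset_mset)
  ultimately have "pr (ab p) \<nu> = pr (ab p) (\<lambda>m. \<Sum>S\<in>N. \<nu> (mset_set S) * mres (desc S) m)"
    by (intro pr_cong) blast
  also have "\<dots> = (\<Sum>S\<in>N. \<nu> (mset_set S) * pr (ab p) (mres (desc S)))"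
    unfolding pr_def sum_distrib_left by (subst sum.swap) (simp add: mult_ac)
  also have "\<dots> = 0" using res0 by simp
  finally show False using \<nu>(2) by simp
qed

text \<open>Since \<open>ab\<close> maps polynomials over \<open>E\<close> onto commutative
  polynomials over \<open>E\<close>, equality of these two kernels is the isomorphism of the
  quotients.\<close>

theorem theorem2p8:
  fixes n :: nat and E :: "(nat \<times> nat) set"
  assumes "E \<subseteq> {1..n} \<times> {1..n}" and "sym E" and "irrefl E"
  shows "FK_ab_kernel n E = {p. nc_over E p \<and> ab p \<in> OT_ideal n E}"
  using OT_ideal_sub_kernel[OF assms] kernel_sub_OT_ideal[OF assms]
  by (auto simp: FK_ab_kernel_def)

end
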